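(* There is a constant $c>0$ such that for arbitrarily large $n$ there exist strings $s$ of length $n$ for which the size of the LZD grammar of $s$ is at least $c\, n^{1/3}\cdot g^*(s)$, and there exist strings $s$ of length $n$ for which the size of the LZMW grammar of $s$ is at least $c\, n^{1/3}\cdot g^*(s)$, where $g^*(s)$ denotes the size of a smallest context-free grammar generating exactly $s$. In other words, the LZD and LZMW grammars can be larger than the smallest grammar by a factor $\Omega(n^{1/3})$.
   Context: Strings are over a finite alphabet $\Sigma$; $s[i..j]$ denotes a substring, and by convention the input string ends with a special letter $\$$ occurring nowhere else. The LZD parsing of $s$ (length $n$) is $s=p_1p_2\cdots p_z$ where, for each $i$, with $k=|p_1\cdots p_{i-1}|+1$, $p_i=p_{i_1}p_{i_2}$, $p_{i_1}$ is the longest prefix of $s[k..n]$ belonging to $\{p_1,\dots,p_{i-1}\}\cup\Sigma$, and $p_{i_2}$ is the longest prefix of $s[k+|p_{i_1}|..n]$ belonging to $\{p_1,\dots,p_{i-1}\}\cup\Sigma$. The LZMW parsing of $s$ is $s=p_1\cdots p_z$ where, with $k$ as before, $p_i$ is the longest prefix of $s[k..n]$ belonging to $\{p_jp_{j+1}: 1\le j\le i-2\}\cup\Sigma$. Each parsing is viewed as a grammar generating only $s$: for each phrase a rule $p_i\to p_jp_k$ ($j,k<i$) or $p_i\to a$ ($a\in\Sigma$), plus the start rule $S\to p_1p_2\cdots p_z$. The size of a grammar is the total number of symbols on the right-hand sides of its rules (so the LZD/LZMW grammar size is $\Theta(z)$). *)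

theory Defs
  imports Complex_Main "HOL-Library.Sublist"
begin

datatype ('n, 't) sym = Nt 'n | Tm 't

type_synonym ('n, 't) prods = "('n \<times> ('n, 't) sym list) set"

inductive cfg_step :: "('n, 't) prods \<Rightarrow> ('n, 't) sym list \<Rightarrow> ('n, 't) sym list \<Rightarrow> bool"
  for P :: "('n, 't) prods" where
  "(A, \<alpha>) \<in> P \<Longrightarrow> cfg_step P (u @ [Nt A] @ v) (u @ \<alpha> @ v)"

definition Lang :: "('n, 't) prods \<Rightarrow> 'n \<Rightarrow> 't list set" where
  "Lang P S = {w. (cfg_step P)\<^sup>*\<^sup>* [Nt S] (map Tm w)}"

definition grammar_size :: "('n, 't) prods \<Rightarrow> nat" where
  "grammar_size P = (\<Sum>(A, \<alpha>)\<in>P. length \<alpha>)"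

text \<open>A finite set of productions mentions finitely many nonterminals, so taking them in
  \<^typ>\<open>nat\<close> is no restriction.\<close>

definition smallest_grammar_size :: "'t list \<Rightarrow> nat" where
  "smallest_grammar_size s =
     (LEAST m. \<exists>(P :: (nat, 't) prods) S. finite P \<and> Lang P S = {s} \<and> grammar_size P = m)"

definition dollar_terminated :: "'a \<Rightarrow> 'a list \<Rightarrow> bool" where
  "dollar_terminated d s \<longleftrightarrow> (\<exists>t. s = t @ [d] \<and> d \<notin> set t)"

definition longest_prefix :: "'a list set \<Rightarrow> 'a list \<Rightarrow> 'a list \<Rightarrow> bool" where
  "longest_prefix D w u \<longleftrightarrow>
     u \<in> D \<and> prefix u w \<and> (\<forall>v\<in>D. prefix v w \<longrightarrow> length v \<le> length u)"

definition lzd_dict :: "'a set \<Rightarrow> 'a list list \<Rightarrow> 'a list set" where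
  "lzd_dict \<Sigma> ps = set ps \<union> {[a] | a. a \<in> \<Sigma>}"

definition lzmw_dict :: "'a set \<Rightarrow> 'a list list \<Rightarrow> 'a list set" where
  "lzmw_dict \<Sigma> ps = {ps ! j @ ps ! Suc j | j. Suc j < length ps} \<union> {[a] | a. a \<in> \<Sigma>}"

text \<open>An LZD parsing is recorded as the list of the pairs of factors of its phrases.
  The second factor is empty exactly if the first one already reaches the end of the string;
  if the string ends with a unique letter, this happens at most for a last phrase consisting of
  that letter alone.\<close>

definition phrases :: "('a list \<times> 'a list) list \<Rightarrow> 'a list list" where
  "phrases fs = map (\<lambda>(u, v). u @ v) fs"

definition lzd_parsing :: "'a set \<Rightarrow> 'a list \<Rightarrow> ('a list \<times> 'a list) list \<Rightarrow> bool" where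
  "lzd_parsing \<Sigma> s fs \<longleftrightarrow>
     concat (phrases fs) = s \<and>
     (\<forall>i < length fs.
        let D = lzd_dict \<Sigma> (phrases (take i fs));
            r = drop (length (concat (phrases (take i fs)))) s;
            (u, v) = fs ! i;
            r' = drop (length u) r
        in longest_prefix D r u \<and> (if r' = [] then v = [] else longest_prefix D r' v))"

definition lzmw_parsing :: "'a set \<Rightarrow> 'a list \<Rightarrow> 'a list list \<Rightarrow> bool" where
  "lzmw_parsing \<Sigma> s ps \<longleftrightarrow>
     concat ps = s \<and>
     (\<forall>i < length ps.
        longest_prefix (lzmw_dict \<Sigma> (take i ps))
          (drop (length (concat (take i ps))) s) (ps ! i))"

text \<open>Nonterminal \<open>0\<close> is the start symbol, and nonterminal \<open>Suc i\<close> stands for the phrase with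
  (zero-based) index \<open>i\<close>.\<close>

definition start_rule :: "nat \<Rightarrow> nat \<times> (nat, 'a) sym list" where
  "start_rule z = (0, map (\<lambda>i. Nt (Suc i)) [0..<z])"

fun lzd_factor :: "'a list list \<Rightarrow> 'a list \<Rightarrow> (nat, 'a) sym list" where
  "lzd_factor ps [] = []"
| "lzd_factor ps [a] = [Tm a]"
| "lzd_factor ps w = [Nt (Suc (LEAST j. j < length ps \<and> ps ! j = w))]"

definition lzd_rules :: "('a list \<times> 'a list) list \<Rightarrow> (nat, 'a) prods" where
  "lzd_rules fs = insert (start_rule (length fs))
     {(Suc i, lzd_factor (phrases fs) u @ lzd_factor (phrases fs) v) | i u v.
        i < length fs \<and> fs ! i = (u, v)}"

definition lzmw_rhs :: "'a list list \<Rightarrow> nat \<Rightarrow> (nat, 'a) sym list" where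
  "lzmw_rhs ps i = (case ps ! i of
       [a] \<Rightarrow> [Tm a]
     | _ \<Rightarrow> let j = (LEAST j. Suc j < i \<and> ps ! j @ ps ! Suc j = ps ! i)
           in [Nt (Suc j), Nt (Suc (Suc j))])"

definition lzmw_rules :: "'a list list \<Rightarrow> (nat, 'a) prods" where
  "lzmw_rules ps = insert (start_rule (length ps)) {(Suc i, lzmw_rhs ps i) | i. i < length ps}"

definition lzd_grammar :: "'a set \<Rightarrow> 'a list \<Rightarrow> (nat, 'a) prods" where
  "lzd_grammar \<Sigma> s = lzd_rules (THE fs. lzd_parsing \<Sigma> s fs)"

definition lzmw_grammar :: "'a set \<Rightarrow> 'a list \<Rightarrow> (nat, 'a) prods" where
  "lzmw_grammar \<Sigma> s = lzmw_rules (THE ps. lzmw_parsing \<Sigma> s ps)"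

lemma longest_prefix_ex1:
  assumes "w \<noteq> []" "set w \<subseteq> \<Sigma>" "{[a] | a. a \<in> \<Sigma>} \<subseteq> D"
  shows "\<exists>!u. longest_prefix D w u"
proof -
  let ?P = "\<lambda>u. u \<in> D \<and> prefix u w"
  have ex: "?P [hd w]"
    using assms by (cases w) auto
  have bd: "\<forall>u. ?P u \<longrightarrow> length u < Suc (length w)"
    by (auto simp: less_Suc_eq_le dest: prefix_length_le)
  from ex_has_greatest_nat[of ?P, OF ex bd] obtain u where
    "?P u" "\<forall>v. ?P v \<longrightarrow> length v \<le> length u" by blast
  then have "longest_prefix D w u"
    by (auto simp: longest_prefix_def)
  moreover have "v = u" if "longest_prefix D w v" "longest_prefix D w u" for u v
    using that unfolding longest_prefix_def
    by (metis prefix_length_prefix prefix_order.antisym)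
  ultimately show ?thesis by blast
qed

lemma greedy_ex1:
  fixes val :: "'x \<Rightarrow> 'a list"
  assumes step: "\<And>h w. (\<forall>x\<in>set h. val x \<noteq> []) \<Longrightarrow> w \<noteq> [] \<Longrightarrow> set w \<subseteq> \<Sigma> \<Longrightarrow> \<exists>!x. step h w x"
    and val: "\<And>h w x. (\<forall>x\<in>set h. val x \<noteq> []) \<Longrightarrow> step h w x \<Longrightarrow> val x \<noteq> [] \<and> prefix (val x) w"
    and h: "\<forall>x\<in>set h. val x \<noteq> []" and w: "set w \<subseteq> \<Sigma>"
  shows "\<exists>!xs. concat (map val xs) = w \<and>
     (\<forall>i < length xs. step (h @ take i xs) (drop (length (concat (map val (take i xs)))) w) (xs ! i))"
  using h w
proof (induction w arbitrary: h rule: length_induct)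
  case (1 w)
  define Q where "Q h w xs \<longleftrightarrow> concat (map val xs) = w \<and>
     (\<forall>i < length xs. step (h @ take i xs) (drop (length (concat (map val (take i xs)))) w) (xs ! i))" for h w xs
  have IH: "\<exists>!xs. Q h' w' xs"
    if "length w' < length w" "\<forall>x\<in>set h'. val x \<noteq> []" "set w' \<subseteq> \<Sigma>" for h' w'
    unfolding Q_def using 1(1) that by simp
  have Cons: "Q h w (x # xs) \<longleftrightarrow>
      step h w x \<and> Q (h @ [x]) (drop (length (val x)) w) xs" for x xs
  proof (cases "step h w x")
    case True
    then obtain r where r: "w = val x @ r"
      using val 1(2) by (metis prefix_def)
    show ?thesis
      using True by (simp add: Q_def All_less_Suc2 r)
  next
    case False
    have "\<not> Q h w (x # xs)"
      using False by (auto simp: Q_def All_less_Suc2)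
    with False show ?thesis by blast
  qed
  show ?case
  proof (cases "w = []")
    case True
    have "\<not> Q h w (x # xs)" for x xs
      unfolding Cons using True val[OF 1(2), of w x] by auto
    then have "Q h w xs \<longleftrightarrow> xs = []" for xs
      using True by (cases xs) (auto simp: Q_def)
    then have "\<exists>!xs. Q h w xs" by simp
    then show ?thesis unfolding Q_def .
  next
    case False
    have ex1: "\<exists>!x. step h w x" by (rule step[OF 1(2) False 1(3)])
    then obtain x where x: "step h w x" by (rule ex1E)
    have vx: "val x \<noteq> []" "prefix (val x) w"
      using val[OF 1(2) x] by auto
    have h': "\<forall>y\<in>set (h @ [x]). val y \<noteq> []" using 1(2) vx by auto
    have "length (drop (length (val x)) w) < length w"
      using vx False by simp
    moreover have "set (drop (length (val x)) w) \<subseteq> \<Sigma>"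
      using 1(3) set_drop_subset by fastforce
    ultimately have ex1': "\<exists>!xs. Q (h @ [x]) (drop (length (val x)) w) xs"
      by (intro IH h')
    then obtain xs where xs: "Q (h @ [x]) (drop (length (val x)) w) xs" by (rule ex1E)
    have "\<exists>!xs. Q h w xs"
    proof (rule ex1I[of _ "x # xs"])
      show "Q h w (x # xs)" unfolding Cons using x xs by blast
    next
      fix ys assume ys: "Q h w ys"
      with False obtain y ys' where [simp]: "ys = y # ys'"
        by (cases ys) (auto simp: Q_def)
      from ys have *: "step h w y" "Q (h @ [y]) (drop (length (val y)) w) ys'"
        unfolding \<open>ys = y # ys'\<close> Cons by blast+
      have "y = x" using *(1) x ex1 by metis
      have "ys' = xs" using *(2) xs ex1' unfolding \<open>y = x\<close> by metis
      show "ys = x # xs" using \<open>y = x\<close> \<open>ys' = xs\<close> by simp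
    qed
    then show ?thesis unfolding Q_def .
  qed
qed

lemma lzd_parsing_ex1:
  assumes "set s \<subseteq> \<Sigma>"
  shows "\<exists>!fs. lzd_parsing \<Sigma> s fs"
proof -
  let ?val = "\<lambda>(u, v). u @ v :: 'a list"
  let ?step = "\<lambda>h w (u, v). longest_prefix (lzd_dict \<Sigma> (phrases h)) w u \<and>
     (if drop (length u) w = [] then v = []
      else longest_prefix (lzd_dict \<Sigma> (phrases h)) (drop (length u) w) v)"
  have "\<exists>!fs. concat (map ?val fs) = s \<and>
     (\<forall>i < length fs. ?step ([] @ take i fs)
        (drop (length (concat (map ?val (take i fs)))) s) (fs ! i))"
  proof (rule greedy_ex1[where \<Sigma> = \<Sigma> and val = ?val and step = ?step])
    fix h and w :: "'a list" assume w: "w \<noteq> []" "set w \<subseteq> \<Sigma>"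
    let ?D = "lzd_dict \<Sigma> (phrases h)"
    have D: "{[a] | a. a \<in> \<Sigma>} \<subseteq> ?D" by (auto simp: lzd_dict_def)
    from longest_prefix_ex1[OF w D] obtain u where
      u: "longest_prefix ?D w u" "\<And>u'. longest_prefix ?D w u' \<Longrightarrow> u' = u" by blast
    have "set (drop (length u) w) \<subseteq> \<Sigma>"
      using w(2) set_drop_subset by fastforce
    then have "\<exists>!v. (if drop (length u) w = [] then v = [] else longest_prefix ?D (drop (length u) w) v)"
      using longest_prefix_ex1[OF _ _ D, of "drop (length u) w"]
      by (cases "drop (length u) w = []") (simp_all del: drop_eq_Nil)
    then obtain v where v: "if drop (length u) w = [] then v = [] else longest_prefix ?D (drop (length u) w) v"
      "\<And>v'. (if drop (length u) w = [] then v' = [] else longest_prefix ?D (drop (length u) w) v') \<Longrightarrow> v' = v"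
      by blast
    show "\<exists>!x. ?step h w x"
    proof (rule ex1I[of _ "(u, v)"])
      show "?step h w (u, v)" using u(1) v(1) by blast
    next
      fix y assume y: "?step h w y"
      obtain u' v' where [simp]: "y = (u', v')" by (cases y)
      have "u' = u" using y u(2) by simp
      moreover have "v' = v" by (rule v(2)) (use y \<open>u' = u\<close> in simp)
      ultimately show "y = (u, v)" by simp
    qed
  next
    fix h w x assume h: "\<forall>x\<in>set h. ?val x \<noteq> []" and "?step h w x"
    moreover obtain u v where "x = (u, v)" by fastforce
    ultimately have uv: "longest_prefix (lzd_dict \<Sigma> (phrases h)) w u"
      "prefix v (drop (length u) w)" "x = (u, v)"
      by (auto simp: longest_prefix_def split: if_splits)
    then have "u \<noteq> []" using h by (auto simp: longest_prefix_def lzd_dict_def phrases_def)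
    moreover from uv have "prefix (u @ v) w"
      by (auto simp: longest_prefix_def prefix_def)
    ultimately show "?val x \<noteq> [] \<and> prefix (?val x) w" using uv by auto
  qed (use assms in auto)
  then show ?thesis
    unfolding lzd_parsing_def phrases_def Let_def case_prod_unfold append_Nil .
qed

lemma lzmw_parsing_ex1:
  assumes "set s \<subseteq> \<Sigma>"
  shows "\<exists>!ps. lzmw_parsing \<Sigma> s ps"
proof -
  have "\<exists>!ps. concat (map (\<lambda>x. x) ps) = s \<and>
     (\<forall>i < length ps. longest_prefix (lzmw_dict \<Sigma> ([] @ take i ps))
        (drop (length (concat (map (\<lambda>x. x) (take i ps)))) s) (ps ! i))"
  proof (rule greedy_ex1[where \<Sigma> = \<Sigma> and val = "\<lambda>x. x"
        and step = "\<lambda>h. longest_prefix (lzmw_dict \<Sigma> h)"])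
    fix h and w :: "'a list" assume w: "w \<noteq> []" "set w \<subseteq> \<Sigma>"
    show "\<exists>!x. longest_prefix (lzmw_dict \<Sigma> h) w x"
      by (rule longest_prefix_ex1[OF w]) (auto simp: lzmw_dict_def)
  next
    fix h and w x :: "'a list"
    assume "\<forall>x\<in>set h. x \<noteq> []" "longest_prefix (lzmw_dict \<Sigma> h) w x"
    then show "x \<noteq> [] \<and> prefix x w"
      by (auto simp: longest_prefix_def lzmw_dict_def)
  qed (use assms in auto)
  then show ?thesis
    by (simp add: lzmw_parsing_def)
qed

lemma cfg_step_append:
  assumes "(cfg_step P)\<^sup>*\<^sup>* x y"
  shows "(cfg_step P)\<^sup>*\<^sup>* (a @ x @ b) (a @ y @ b)"
  using assms
proof (induction rule: rtranclp_induct)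
  case (step y z)
  from step(2) obtain A \<alpha> u v where
    "(A, \<alpha>) \<in> P" "y = u @ [Nt A] @ v" "z = u @ \<alpha> @ v"
    by (auto elim: cfg_step.cases)
  then have "cfg_step P (a @ y @ b) (a @ z @ b)"
    using cfg_step.intros[of A \<alpha> P "a @ u" "v @ b"] by simp
  with step(3) show ?case by simp
qed simp

lemma Lang_straight_line:
  fixes val :: "'n \<Rightarrow> 't list" and rank :: "'n \<Rightarrow> nat"
  defines "ev \<equiv> (\<lambda>x. case x of Nt A \<Rightarrow> val A | Tm a \<Rightarrow> [a])"
  assumes sound: "\<And>A \<alpha>. (A, \<alpha>) \<in> P \<Longrightarrow> concat (map ev \<alpha>) = val A"
    and total: "\<And>A. A \<in> N \<Longrightarrow> \<exists>\<alpha>. (A, \<alpha>) \<in> P \<and> (\<forall>B. Nt B \<in> set \<alpha> \<longrightarrow> B \<in> N \<and> rank B < rank A)"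
    and S: "S \<in> N"
  shows "Lang P S = {val S}"
proof -
  have inv: "concat (map ev y) = concat (map ev x)" if "(cfg_step P)\<^sup>*\<^sup>* x y" for x y
    using that
  proof (induction rule: rtranclp_induct)
    case (step y z)
    from step(2) have "concat (map ev z) = concat (map ev y)"
      by cases (simp add: sound, simp add: ev_def)
    with step(3) show ?case by simp
  qed simp
  have word: "concat (map ev (map Tm w)) = w" for w
    by (induction w) (auto simp: ev_def)
  have reach: "(cfg_step P)\<^sup>*\<^sup>* [Nt A] (map Tm (val A))" if "A \<in> N" for A
    using that
  proof (induction "rank A" arbitrary: A rule: less_induct)
    case less
    from total[OF less(2)] obtain \<alpha> where
      \<alpha>: "(A, \<alpha>) \<in> P" "\<forall>B. Nt B \<in> set \<alpha> \<longrightarrow> B \<in> N \<and> rank B < rank A" by blast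
    have "(cfg_step P)\<^sup>*\<^sup>* \<beta> (map Tm (concat (map ev \<beta>)))" if "set \<beta> \<subseteq> set \<alpha>" for \<beta>
      using that
    proof (induction \<beta>)
      case (Cons x \<beta>)
      have "(cfg_step P)\<^sup>*\<^sup>* [x] (map Tm (ev x))"
      proof (cases x)
        case (Nt B)
        then have "B \<in> N" "rank B < rank A" using \<alpha>(2) Cons(2) by auto
        with less(1) Nt show ?thesis by (simp add: ev_def)
      qed (simp add: ev_def)
      from cfg_step_append[OF this, of "[]" \<beta>]
      have "(cfg_step P)\<^sup>*\<^sup>* (x # \<beta>) (map Tm (ev x) @ \<beta>)" by simp
      also have "(cfg_step P)\<^sup>*\<^sup>* (map Tm (ev x) @ \<beta>)
          (map Tm (ev x) @ map Tm (concat (map ev \<beta>)))"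
        using cfg_step_append[OF Cons(1), of "map Tm (ev x)" "[]"] Cons(2) by simp
      finally show ?case by simp
    qed simp
    from this[of \<alpha>] have "(cfg_step P)\<^sup>*\<^sup>* \<alpha> (map Tm (val A))" by (simp add: sound[OF \<alpha>(1)])
    moreover have "cfg_step P [Nt A] \<alpha>"
      using cfg_step.intros[OF \<alpha>(1), of "[]" "[]"] by simp
    ultimately show ?case by (rule converse_rtranclp_into_rtranclp[rotated])
  qed
  have sub: "w = val S" if "(cfg_step P)\<^sup>*\<^sup>* [Nt S] (map Tm w)" for w
    using inv[OF that] unfolding word by (simp add: ev_def)
  show ?thesis
  proof (intro set_eqI iffI)
    fix w assume "w \<in> Lang P S"
    then have "(cfg_step P)\<^sup>*\<^sup>* [Nt S] (map Tm w)" by (simp only: Lang_def mem_Collect_eq)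
    from sub[OF this] show "w \<in> {val S}" by (simp only: singleton_iff)
  next
    fix w assume "w \<in> {val S}"
    then show "w \<in> Lang P S"
      using reach[OF S] by (simp only: Lang_def mem_Collect_eq singleton_iff)
  qed
qed

lemma concat_phrase_symbols:
  "concat (map (\<lambda>x. case x of Nt A \<Rightarrow> case_nat s ((!) ps) A | Tm a \<Rightarrow> [a])
     (map (\<lambda>i. Nt (Suc i)) [0..<length ps])) = concat ps"
proof -
  have "map (\<lambda>i. ps ! i) [0..<length ps] = ps" by (rule map_nth)
  then show ?thesis by (simp add: comp_def)
qed

lemma lzd_factor_correct:
  assumes "w = [] \<or> w \<in> lzd_dict \<Sigma> (take i ps)"
  shows "concat (map (\<lambda>x. case x of Nt A \<Rightarrow> case_nat s ((!) ps) A | Tm a \<Rightarrow> [a]) (lzd_factor ps w)) = w"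
    and "Nt B \<in> set (lzd_factor ps w) \<Longrightarrow> \<exists>j < i. j < length ps \<and> B = Suc j"
proof -
  have *: "(LEAST j. j < length ps \<and> ps ! j = w) < i \<and>
      (LEAST j. j < length ps \<and> ps ! j = w) < length ps \<and>
      ps ! (LEAST j. j < length ps \<and> ps ! j = w) = w"
    if "length w \<ge> 2"
  proof -
    from assms that have "w \<in> set (take i ps)" by (auto simp: lzd_dict_def)
    then obtain j where j: "j < i" "j < length ps \<and> ps ! j = w"
      by (auto simp: in_set_conv_nth)
    from LeastI[of "\<lambda>j. j < length ps \<and> ps ! j = w", OF j(2)]
      Least_le[of "\<lambda>j. j < length ps \<and> ps ! j = w", OF j(2)] j(1)
    show ?thesis by linarith
  qed
  consider "w = []" | a where "w = [a]" | a b r where "w = a # b # r"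
    by (metis neq_Nil_conv)
  then show "concat (map (\<lambda>x. case x of Nt A \<Rightarrow> case_nat s ((!) ps) A | Tm a \<Rightarrow> [a]) (lzd_factor ps w)) = w"
    and "Nt B \<in> set (lzd_factor ps w) \<Longrightarrow> \<exists>j < i. j < length ps \<and> B = Suc j"
    using * by (cases; auto)+
qed

lemma lzd_rules_Lang:
  assumes "lzd_parsing \<Sigma> s fs"
  shows "Lang (lzd_rules fs) 0 = {s}"
proof -
  let ?ps = "phrases fs"
  let ?val = "case_nat s ((!) ?ps)"
  have len: "length ?ps = length fs" by (simp add: phrases_def)
  have cat: "concat ?ps = s" using assms by (simp add: lzd_parsing_def)
  have dict: "u = [] \<or> u \<in> lzd_dict \<Sigma> (take i ?ps)" "v = [] \<or> v \<in> lzd_dict \<Sigma> (take i ?ps)"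
    "?ps ! i = u @ v"
    if "i < length fs" "fs ! i = (u, v)" for i u v
    using assms that
    by (auto simp: lzd_parsing_def Let_def longest_prefix_def phrases_def take_map split: if_splits)
  have "Lang (lzd_rules fs) 0 = {?val 0}"
  proof (rule Lang_straight_line[where N = "{..length fs}" and rank = "case_nat (Suc (length fs)) (\<lambda>i. i)"])
    fix A \<alpha> assume "(A, \<alpha>) \<in> lzd_rules fs"
    then consider "(A, \<alpha>) = start_rule (length fs)"
      | i u v where "A = Suc i" "\<alpha> = lzd_factor ?ps u @ lzd_factor ?ps v" "i < length fs" "fs ! i = (u, v)"
      by (auto simp: lzd_rules_def)
    then show "concat (map (\<lambda>x. case x of Nt A \<Rightarrow> ?val A | Tm a \<Rightarrow> [a]) \<alpha>) = ?val A"
    proof cases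
      case 1
      then show ?thesis using concat_phrase_symbols[of s ?ps] cat len by (simp add: start_rule_def)
    next
      case 2
      then show ?thesis
        using lzd_factor_correct(1)[OF dict(1)] lzd_factor_correct(1)[OF dict(2)] dict(3) by simp
    qed
  next
    fix A assume A: "A \<in> {..length fs}"
    show "\<exists>\<alpha>. (A, \<alpha>) \<in> lzd_rules fs \<and> (\<forall>B. Nt B \<in> set \<alpha> \<longrightarrow> B \<in> {..length fs} \<and>
        case_nat (Suc (length fs)) (\<lambda>i. i) B < case_nat (Suc (length fs)) (\<lambda>i. i) A)"
    proof (cases A)
      case 0
      show ?thesis
        by (rule exI[of _ "snd (start_rule (length fs))"])
          (auto simp: lzd_rules_def start_rule_def 0)
    next
      case (Suc i)
      obtain u v where uv: "fs ! i = (u, v)" by fastforce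
      have i: "i < length fs" using A Suc by simp
      show ?thesis
      proof (intro exI conjI allI impI)
        show "(A, lzd_factor ?ps u @ lzd_factor ?ps v) \<in> lzd_rules fs"
          using i uv Suc by (auto simp: lzd_rules_def)
        fix B assume "Nt B \<in> set (lzd_factor ?ps u @ lzd_factor ?ps v)"
        then obtain j where "j < i" "B = Suc j"
          using lzd_factor_correct(2)[OF dict(1)[OF i uv]] lzd_factor_correct(2)[OF dict(2)[OF i uv]]
          by (metis Un_iff set_append)
        then show "B \<in> {..length fs}"
          "case_nat (Suc (length fs)) (\<lambda>i. i) B < case_nat (Suc (length fs)) (\<lambda>i. i) A"
          using i Suc by auto
      qed
    qed
  qed simp
  then show ?thesis by simp
qed

lemma lzmw_rhs_cases:
  assumes "lzmw_parsing \<Sigma> s ps" "i < length ps"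
  obtains a where "ps ! i = [a]" "lzmw_rhs ps i = [Tm a]"
  | j where "Suc j < i" "ps ! j @ ps ! Suc j = ps ! i" "lzmw_rhs ps i = [Nt (Suc j), Nt (Suc (Suc j))]"
proof -
  let ?j = "LEAST j. Suc j < i \<and> ps ! j @ ps ! Suc j = ps ! i"
  have "ps ! i \<in> lzmw_dict \<Sigma> (take i ps)"
    using assms by (auto simp: lzmw_parsing_def longest_prefix_def)
  then consider a where "ps ! i = [a]" | j where "Suc j < i \<and> ps ! j @ ps ! Suc j = ps ! i"
    using assms(2) by (auto simp: lzmw_dict_def)
  then show thesis
  proof cases
    case 1
    then show thesis using that(1) by (simp add: lzmw_rhs_def)
  next
    case 2
    then have j: "Suc ?j < i \<and> ps ! ?j @ ps ! Suc ?j = ps ! i" by (rule LeastI)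
    consider a where "ps ! i = [a]" | "ps ! i = []" | a b r where "ps ! i = a # b # r"
      by (metis neq_Nil_conv)
    then show thesis
      using j that by cases (auto simp: lzmw_rhs_def Let_def)
  qed
qed

lemma lzmw_rules_Lang:
  assumes "lzmw_parsing \<Sigma> s ps"
  shows "Lang (lzmw_rules ps) 0 = {s}"
proof -
  let ?val = "case_nat s ((!) ps)"
  have cat: "concat ps = s" using assms by (simp add: lzmw_parsing_def)
  have "Lang (lzmw_rules ps) 0 = {?val 0}"
  proof (rule Lang_straight_line[where N = "{..length ps}" and rank = "case_nat (Suc (length ps)) (\<lambda>i. i)"])
    fix A \<alpha> assume "(A, \<alpha>) \<in> lzmw_rules ps"
    then consider "(A, \<alpha>) = start_rule (length ps)"
      | i where "A = Suc i" "\<alpha> = lzmw_rhs ps i" "i < length ps"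
      by (auto simp: lzmw_rules_def)
    then show "concat (map (\<lambda>x. case x of Nt A \<Rightarrow> ?val A | Tm a \<Rightarrow> [a]) \<alpha>) = ?val A"
    proof cases
      case 1
      then show ?thesis using concat_phrase_symbols[of s ps] cat by (simp add: start_rule_def)
    next
      case 2
      from lzmw_rhs_cases[OF assms 2(3)] show ?thesis by cases (auto simp: 2)
    qed
  next
    fix A assume A: "A \<in> {..length ps}"
    show "\<exists>\<alpha>. (A, \<alpha>) \<in> lzmw_rules ps \<and> (\<forall>B. Nt B \<in> set \<alpha> \<longrightarrow> B \<in> {..length ps} \<and>
        case_nat (Suc (length ps)) (\<lambda>i. i) B < case_nat (Suc (length ps)) (\<lambda>i. i) A)"
    proof (cases A)
      case 0
      show ?thesis
        by (rule exI[of _ "snd (start_rule (length ps))"])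
          (auto simp: lzmw_rules_def start_rule_def 0)
    next
      case (Suc i)
      have i: "i < length ps" using A Suc by simp
      have "(A, lzmw_rhs ps i) \<in> lzmw_rules ps" using i Suc by (auto simp: lzmw_rules_def)
      moreover from lzmw_rhs_cases[OF assms i] i Suc have
        "\<forall>B. Nt B \<in> set (lzmw_rhs ps i) \<longrightarrow> B \<in> {..length ps} \<and>
        case_nat (Suc (length ps)) (\<lambda>i. i) B < case_nat (Suc (length ps)) (\<lambda>i. i) A"
        by cases auto
      ultimately show ?thesis by blast
    qed
  qed simp
  then show ?thesis by simp
qed

theorem lzd_grammar_Lang: "set s \<subseteq> \<Sigma> \<Longrightarrow> Lang (lzd_grammar \<Sigma> s) 0 = {s}"
  unfolding lzd_grammar_def by (rule lzd_rules_Lang, rule theI', rule lzd_parsing_ex1)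

theorem lzmw_grammar_Lang: "set s \<subseteq> \<Sigma> \<Longrightarrow> Lang (lzmw_grammar \<Sigma> s) 0 = {s}"
  unfolding lzmw_grammar_def by (rule lzmw_rules_Lang, rule theI', rule lzmw_parsing_ex1)

end

theory Submission imports Defs begin

text \<open>
  For \<open>k = 2 m\<close> put \<open>\<delta>\<^sub>j = a\<^sup>j b a\<^sup>k\<^sup>-\<^sup>j\<close>. The heart of the string is \<open>x\<^sup>m a\<^sup>m\<close>, where \<open>x\<close> consists of \<open>O(m)\<close>
  blocks \<open>a\<^sup>p b\<close> with \<open>p = O(m)\<close>; it has length \<open>O(m\<^sup>3)\<close> and a grammar of size \<open>O(m)\<close>. If the dictionary
  contains \<open>a\<^sup>k\<close> and all \<open>\<delta>\<^sub>j\<close>, then the \<open>t\<close>-th copy of \<open>x\<close> is parsed, shifted by \<open>t\<close> positions, into the pairs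
  \<open>\<delta>\<^sub>k\<^sub>-\<^sub>t \<delta>\<^sub>k\<^sub>-\<^sub>i\<^sub>-\<^sub>t\<close> (\<open>i < m\<close>) followed by \<open>\<delta>\<^sub>k\<^sub>-\<^sub>t a\<^sup>k\<close>. The last pair moves the parsing by one position,
  so that no phrase of an earlier copy is ever found again and each of the \<open>m\<close> copies costs \<open>m\<close> new phrases.
  A preamble of length \<open>O(m\<^sup>2)\<close> with a grammar of size \<open>O(m)\<close> brings the words \<open>a\<^sup>i\<close>, \<open>a\<^sup>i b\<close> and \<open>\<delta>\<^sub>j\<close>
  into the dictionary. Hence there are at least \<open>m\<^sup>2\<close> phrases, against a grammar of size \<open>O(m)\<close> and \<open>n = O(m\<^sup>3)\<close>.
  The factors of the LZD phrases are the LZMW phrases, so one string serves both parsings.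
\<close>

section \<open>Simultaneous LZD and LZMW parsings\<close>

lemma phrases_simps [simp]:
  "phrases [] = []" "phrases ((u, v) # fs) = (u @ v) # phrases fs"
  "phrases (fs @ gs) = phrases fs @ phrases gs"
  by (simp_all add: phrases_def)

definition flat :: "('a list \<times> 'a list) list \<Rightarrow> 'a list list" where
  "flat fs = concat (map (\<lambda>(u, v). [u, v]) fs)"

lemma flat_simps [simp]:
  "flat [] = []" "flat ((u, v) # fs) = u # v # flat fs"
  by (simp_all add: flat_def)

lemma concat_flat: "concat (flat fs) = concat (phrases fs)"
  by (induction fs) (auto simp: flat_def phrases_def)

lemma length_flat: "length (flat fs) = 2 * length fs"
  by (induction fs) auto

text \<open>This is the maximality half of \<open>longest_prefix\<close>. It is antitone in
  \<open>P\<close>, so it may be checked against a coarse superset of the dictionary, while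
  membership of the chosen word is checked against a subset.\<close>

definition short_prefixes :: "'a list set \<Rightarrow> 'a list \<Rightarrow> 'a list \<Rightarrow> bool" where
  "short_prefixes P w u \<longleftrightarrow> (\<forall>x\<in>P. prefix x w \<longrightarrow> length x \<le> length u)"

text \<open>
  A Hoare-style description of a parsing in progress, with \<open>r\<close> the rest of the text after \<open>fs\<close>. The
  dictionaries of both parsings contain \<open>L\<close> and, up to single letters, are contained in \<open>P\<close>; \<open>l\<close> is the
  latest LZMW phrase, so that \<open>l @ u\<close> enters the LZMW dictionary after \<open>u\<close>. Primed arguments bound the final state.
\<close>

fun parses :: "'a list set \<Rightarrow> 'a list set \<Rightarrow> 'a list \<Rightarrow> ('a list \<times> 'a list) list \<Rightarrow> 'a list \<Rightarrow>
    'a list set \<Rightarrow> 'a list set \<Rightarrow> 'a list \<Rightarrow> bool" where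
  "parses L P l [] r L' P' l' \<longleftrightarrow> L' \<subseteq> L \<and> P \<subseteq> P' \<and> l' = l"
| "parses L P l ((u, v) # fs) r L' P' l' \<longleftrightarrow>
     u \<in> L \<and> v \<in> L \<and>
     short_prefixes P (u @ v @ concat (phrases fs) @ r) u \<and>
     short_prefixes (insert (l @ u) P) (v @ concat (phrases fs) @ r) v \<and>
     parses (insert (u @ v) L) (insert (u @ v) (insert (l @ u) P)) v fs r L' P' l'"

lemma short_prefixes_antimono: "short_prefixes P w u \<Longrightarrow> Q \<subseteq> P \<Longrightarrow> short_prefixes Q w u"
  by (auto simp: short_prefixes_def)

text \<open>The consequence rule of the calculus; \<open>parses_append\<close> is its sequencing
  rule and \<open>parses_loop\<close> its loop rule, with an invariant indexed by the
  iteration.\<close>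

lemma parses_weaken:
  "parses L P l fs r L' P' l' \<Longrightarrow> L \<subseteq> K \<Longrightarrow> Q \<subseteq> P \<Longrightarrow> parses K Q l fs r L' P' l'"
proof (induction L P l fs r L' P' l' arbitrary: K Q rule: parses.induct)
  case (2 L P l u v fs r L' P' l')
  have "parses (insert (u @ v) K) (insert (u @ v) (insert (l @ u) Q)) v fs r L' P' l'"
    by (rule 2(1)) (use 2 in auto)
  with 2 show ?case
    by (auto intro: short_prefixes_antimono[of P] short_prefixes_antimono[of "insert (l @ u) P"])
qed auto

lemma parses_append:
  "parses L P l xs (concat (phrases ys) @ r) L1 P1 l1 \<Longrightarrow> parses L1 P1 l1 ys r L2 P2 l2 \<Longrightarrow>
   parses L P l (xs @ ys) r L2 P2 l2"
  by (induction L P l xs r L2 P2 l2 rule: parses.induct) (auto intro: parses_weaken)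

lemma parses_loop:
  assumes "\<And>i. i < n \<Longrightarrow> parses (L i) (P i) (l i) (U i) (R (Suc i)) (L (Suc i)) (P (Suc i)) (l (Suc i))"
    and "\<And>i. i < n \<Longrightarrow> R i = concat (phrases (U i)) @ R (Suc i)"
  shows "parses (L 0) (P 0) (l 0) (concat (map U [0..<n])) (R n) (L n) (P n) (l n)"
proof -
  have "parses (L 0) (P 0) (l 0) (concat (map U [0..<j])) (R j) (L j) (P j) (l j)" if "j \<le> n" for j
    using that
  proof (induction j)
    case (Suc j)
    then have "parses (L 0) (P 0) (l 0) (concat (map U [0..<j]) @ U j) (R (Suc j))
       (L (Suc j)) (P (Suc j)) (l (Suc j))"
      using assms[of j] by (intro parses_append) auto
    then show ?case by simp
  qed simp
  then show ?thesis by simp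
qed

definition remaining :: "(nat \<Rightarrow> ('a list \<times> 'a list) list) \<Rightarrow> nat \<Rightarrow> 'a list \<Rightarrow> nat \<Rightarrow> 'a list" where
  "remaining U n r i = concat (phrases (concat (map U [i..<n]))) @ r"

lemma remaining_end [simp]: "remaining U n r n = r"
  by (simp add: remaining_def)

lemma remaining_step: "i < n \<Longrightarrow> remaining U n r i = concat (phrases (U i)) @ remaining U n r (Suc i)"
  by (simp add: remaining_def upt_conv_Cons)

section \<open>From tracked bounds to actual LZD and LZMW parsings\<close>

lemma lzmw_dict_snoc:
  "lzmw_dict \<Sigma> (h @ [q]) = lzmw_dict \<Sigma> h \<union> (if h = [] then {} else {last h @ q})"
proof -
  have "{(h @ [q]) ! j @ (h @ [q]) ! Suc j | j. Suc j < length (h @ [q])} =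
     {h ! j @ h ! Suc j | j. Suc j < length h} \<union> (if h = [] then {} else {last h @ q})"
    (is "?A = ?B")
  proof (intro set_eqI iffI)
    fix w assume "w \<in> ?A"
    then obtain j where j: "w = (h @ [q]) ! j @ (h @ [q]) ! Suc j" "j < length h" by auto
    show "w \<in> ?B"
    proof (cases "Suc j < length h")
      case False
      then have "j = length h - 1" "h \<noteq> []" "Suc j = length h" using j by auto
      then show ?thesis using j by (simp add: nth_append last_conv_nth)
    qed (use j in \<open>auto simp: nth_append\<close>)
  next
    fix w assume "w \<in> ?B"
    then consider j where "w = h ! j @ h ! Suc j" "Suc j < length h" | "h \<noteq> []" "w = last h @ q"
      by (auto split: if_splits)
    then show "w \<in> ?A"
    proof cases
      case 1
      then show ?thesis by (auto simp: nth_append intro!: exI[of _ j])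
    next
      case 2
      then show ?thesis by (auto simp: nth_append last_conv_nth intro!: exI[of _ "length h - 1"])
    qed
  qed
  then show ?thesis by (simp add: lzmw_dict_def Un_ac)
qed

text \<open>Letters may be left out of \<open>P\<close>: the chosen word is nonempty, so no letter
  is longer than it.\<close>

lemma longest_prefixI:
  assumes "u \<in> D" "u \<noteq> []" "D \<subseteq> P \<union> {[a] | a. a \<in> \<Sigma>}" "short_prefixes P (u @ w) u"
  shows "longest_prefix D (u @ w) u"
  using assms by (fastforce simp: longest_prefix_def short_prefixes_def Suc_le_eq)

text \<open>The history \<open>h\<close> is generalised so that the induction can peel off one pair
  at a time. A pair yields two LZMW phrases: indices 0 and 1 are its factors, larger ones fall under
  the induction hypothesis with history \<open>h @ [u, v]\<close>.\<close>

lemma parses_lzmw: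
  assumes "parses L P l fs r L' P' l'" "[] \<notin> L" "L \<subseteq> lzmw_dict \<Sigma> h"
    "lzmw_dict \<Sigma> h \<subseteq> P \<union> {[a] | a. a \<in> \<Sigma>}" "h \<noteq> [] \<longrightarrow> l = last h" "i < length (flat fs)"
  shows "longest_prefix (lzmw_dict \<Sigma> (h @ take i (flat fs))) (concat (drop i (flat fs)) @ r) (flat fs ! i)"
  using assms
proof (induction L P l fs r L' P' l' arbitrary: h i rule: parses.induct)
  case (2 L P l u v fs r L' P' l')
  have uv: "u \<noteq> []" "v \<noteq> []" using 2 by auto
  have d1: "lzmw_dict \<Sigma> (h @ [u]) \<subseteq> insert (l @ u) P \<union> {[a] | a. a \<in> \<Sigma>}"
    using 2(5,6) by (auto simp: lzmw_dict_snoc)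
  have d2: "lzmw_dict \<Sigma> (h @ [u, v]) = lzmw_dict \<Sigma> (h @ [u]) \<union> {u @ v}"
    using lzmw_dict_snoc[of \<Sigma> "h @ [u]" v] by simp
  have L1: "L \<subseteq> lzmw_dict \<Sigma> (h @ [u])" using 2(4) by (auto simp: lzmw_dict_snoc)
  consider "i = 0" | "i = 1" | j where "i = Suc (Suc j)" "j < length (flat fs)"
    using 2(7) by (metis One_nat_def Suc_less_eq flat_simps(2) length_Cons not0_implies_Suc)
  then show ?case
  proof cases
    case 1
    have "longest_prefix (lzmw_dict \<Sigma> h) (u @ v @ concat (phrases fs) @ r) u"
      by (rule longest_prefixI[where P = P and \<Sigma> = \<Sigma>]) (use 2 uv in auto)
    then show ?thesis using 1 by (simp add: concat_flat)
  next
    case i: 2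
    have "longest_prefix (lzmw_dict \<Sigma> (h @ [u])) (v @ concat (phrases fs) @ r) v"
      by (rule longest_prefixI[where P = "insert (l @ u) P" and \<Sigma> = \<Sigma>])
        (use 2(2) uv d1 L1 in auto)
    then show ?thesis using i by (simp add: concat_flat)
  next
    case 3
    have "longest_prefix (lzmw_dict \<Sigma> ((h @ [u, v]) @ take j (flat fs)))
        (concat (drop j (flat fs)) @ r) (flat fs ! j)"
      by (rule 2(1)) (use 2(2,3,4) uv d1 d2 L1 3 in auto)
    then show ?thesis using 3 by simp
  qed
qed simp

lemma lzd_dict_snoc: "lzd_dict \<Sigma> (ps @ [p]) = insert p (lzd_dict \<Sigma> ps)"
  by (auto simp: lzd_dict_def)

lemma parses_lzd:
  assumes "parses L P l fs r L' P' l'" "[] \<notin> L" "L \<subseteq> lzd_dict \<Sigma> h"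
    "lzd_dict \<Sigma> h \<subseteq> P \<union> {[a] | a. a \<in> \<Sigma>}" "i < length fs" "fs ! i = (u, v)"
  shows "v \<noteq> [] \<and>
    longest_prefix (lzd_dict \<Sigma> (h @ phrases (take i fs))) (concat (phrases (drop i fs)) @ r) u \<and>
    longest_prefix (lzd_dict \<Sigma> (h @ phrases (take i fs)))
      (v @ concat (phrases (drop (Suc i) fs)) @ r) v"
  using assms
proof (induction L P l fs r L' P' l' arbitrary: h i rule: parses.induct)
  case (2 L P l u1 v1 fs r L' P' l')
  have uv: "u1 \<noteq> []" "v1 \<noteq> []" using 2 by auto
  show ?case
  proof (cases i)
    case 0
    have "longest_prefix (lzd_dict \<Sigma> h) (u1 @ v1 @ concat (phrases fs) @ r) u1"
      by (rule longest_prefixI[where P = P and \<Sigma> = \<Sigma>]) (use 2 uv in auto)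
    \<comment> \<open>LZD does not record \<open>l @ u1\<close>; the bound containing this word is
      merely larger than required here.\<close>
    moreover have "longest_prefix (lzd_dict \<Sigma> h) (v1 @ concat (phrases fs) @ r) v1"
      by (rule longest_prefixI[where P = "insert (l @ u1) P" and \<Sigma> = \<Sigma>]) (use 2 uv in auto)
    ultimately show ?thesis using 0 2(7) uv by simp
  next
    case (Suc j)
    have "v \<noteq> [] \<and>
      longest_prefix (lzd_dict \<Sigma> ((h @ [u1 @ v1]) @ phrases (take j fs))) (concat (phrases (drop j fs)) @ r) u \<and>
      longest_prefix (lzd_dict \<Sigma> ((h @ [u1 @ v1]) @ phrases (take j fs)))
        (v @ concat (phrases (drop (Suc j) fs)) @ r) v"
      by (rule 2(1)) (use 2(2-7) uv Suc in \<open>auto simp: lzd_dict_snoc\<close>)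
    then show ?thesis using Suc by simp
  qed
qed simp

text \<open>At the start only letters are available and nothing has been recorded. All second
  factors are nonempty, so the clause of \<open>lzd_parsing\<close> for an exhausted text never
  applies.\<close>

theorem parses_imp_parsings:
  assumes "parses {[a] | a. a \<in> \<Sigma>} {} [] fs [] L' P' l'"
  shows "lzd_parsing \<Sigma> (concat (phrases fs)) fs"
    and "lzmw_parsing \<Sigma> (concat (phrases fs)) (flat fs)"
proof -
  have split: "drop (length (concat (phrases (take i fs)))) (concat (phrases fs)) = concat (phrases (drop i fs))" for i
  proof -
    have "concat (phrases fs) = concat (phrases (take i fs)) @ concat (phrases (drop i fs))"
      by (metis append_take_drop_id concat_append phrases_simps(3))
    then show ?thesis by simp
  qed
  show "lzd_parsing \<Sigma> (concat (phrases fs)) fs"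
    unfolding lzd_parsing_def Let_def
  proof (intro conjI allI impI refl)
    fix i assume i: "i < length fs"
    obtain u v where uv: "fs ! i = (u, v)" by fastforce
    have d: "drop i fs = (u, v) # drop (Suc i) fs"
      using i uv by (metis Cons_nth_drop_Suc)
    from parses_lzd[OF assms _ _ _ i uv, of \<Sigma> "[]"]
    show "case fs ! i of (u, v) \<Rightarrow>
        longest_prefix (lzd_dict \<Sigma> (phrases (take i fs)))
          (drop (length (concat (phrases (take i fs)))) (concat (phrases fs))) u \<and>
        (if drop (length u) (drop (length (concat (phrases (take i fs)))) (concat (phrases fs))) = []
         then v = []
         else longest_prefix (lzd_dict \<Sigma> (phrases (take i fs)))
            (drop (length u) (drop (length (concat (phrases (take i fs)))) (concat (phrases fs)))) v)"
      unfolding split uv by (simp add: d lzd_dict_def)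
  qed
  have split: "drop (length (concat (take i (flat fs)))) (concat (flat fs)) = concat (drop i (flat fs))" for i
  proof -
    have "concat (flat fs) = concat (take i (flat fs)) @ concat (drop i (flat fs))"
      by (metis append_take_drop_id concat_append)
    then show ?thesis by simp
  qed
  show "lzmw_parsing \<Sigma> (concat (phrases fs)) (flat fs)"
    unfolding lzmw_parsing_def concat_flat[symmetric] split
    using parses_lzmw[OF assms, of \<Sigma> "[]"] by (auto simp: lzmw_dict_def)
qed

section \<open>Grammar sizes\<close>

lemma grammar_size_ge_rule: "finite P \<Longrightarrow> (A, \<alpha>) \<in> P \<Longrightarrow> length \<alpha> \<le> grammar_size P"
  unfolding grammar_size_def
  using member_le_sum[of "(A, \<alpha>)" P "\<lambda>(A, \<alpha>). length \<alpha>"] by auto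

text \<open>The start rule alone has one symbol per phrase, and uniqueness of the parsing identifies
  the one chosen by \<open>THE\<close>.\<close>

lemma lzd_grammar_size_ge:
  assumes "lzd_parsing \<Sigma> s fs" "set s \<subseteq> \<Sigma>"
  shows "length fs \<le> grammar_size (lzd_grammar \<Sigma> s)"
proof -
  have "(THE fs. lzd_parsing \<Sigma> s fs) = fs"
    using assms lzd_parsing_ex1 by (intro the1_equality)
  moreover have "finite (lzd_rules fs)"
  proof -
    have "{(Suc i, lzd_factor (phrases fs) u @ lzd_factor (phrases fs) v) | i u v.
        i < length fs \<and> fs ! i = (u, v)} =
      (\<lambda>i. (Suc i, lzd_factor (phrases fs) (fst (fs ! i)) @ lzd_factor (phrases fs) (snd (fs ! i)))) ` {..<length fs}"
      by force
    then show ?thesis by (simp add: lzd_rules_def)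
  qed
  ultimately show ?thesis
    using grammar_size_ge_rule[of "lzd_rules fs" 0 "snd (start_rule (length fs))"]
    by (simp add: lzd_grammar_def lzd_rules_def start_rule_def)
qed

lemma lzmw_grammar_size_ge:
  assumes "lzmw_parsing \<Sigma> s ps" "set s \<subseteq> \<Sigma>"
  shows "length ps \<le> grammar_size (lzmw_grammar \<Sigma> s)"
proof -
  have "(THE ps. lzmw_parsing \<Sigma> s ps) = ps"
    using assms lzmw_parsing_ex1 by (intro the1_equality)
  moreover have "finite (lzmw_rules ps)" by (simp add: lzmw_rules_def)
  ultimately show ?thesis
    using grammar_size_ge_rule[of "lzmw_rules ps" 0 "snd (start_rule (length ps))"]
    by (simp add: lzmw_grammar_def lzmw_rules_def start_rule_def)
qed

section \<open>Straight-line programs as upper bounds for the smallest grammar\<close>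

inductive slp :: "'a list set \<Rightarrow> nat \<Rightarrow> bool" where
  empty: "slp {} 0"
| rule: "slp V n \<Longrightarrow> set \<alpha> \<subseteq> V \<union> {[a] | a. True} \<Longrightarrow> length \<alpha> \<le> c \<Longrightarrow> slp (insert (concat \<alpha>) V) (n + c)"

abbreviation expand :: "('n \<Rightarrow> 'a list) \<Rightarrow> ('n, 'a) sym \<Rightarrow> 'a list" where
  "expand val \<equiv> \<lambda>x. case x of Nt A \<Rightarrow> val A | Tm a \<Rightarrow> [a]"

text \<open>Nonterminals are numbered in order of creation, so every right-hand side refers to
  smaller numbers only. This order serves as the rank in \<open>Lang_straight_line\<close>.\<close>

definition slp_rules :: "(nat, 'a) prods \<Rightarrow> (nat \<Rightarrow> 'a list) \<Rightarrow> nat \<Rightarrow> bool" where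
  "slp_rules P val q \<longleftrightarrow> finite P \<and>
     (\<forall>A \<alpha>. (A, \<alpha>) \<in> P \<longrightarrow> A < q \<and> (\<forall>B. Nt B \<in> set \<alpha> \<longrightarrow> B < A) \<and> concat (map (expand val) \<alpha>) = val A) \<and>
     (\<forall>A<q. \<exists>\<alpha>. (A, \<alpha>) \<in> P)"

lemma slp_grammar:
  fixes V :: "'a list set"
  assumes "slp V n"
  shows "\<exists>P val q. slp_rules P val q \<and> grammar_size P \<le> n \<and> V = val ` {..<q}"
  using assms
proof induction
  case empty
  have "slp_rules {} (\<lambda>_. []) 0" "grammar_size ({} :: (nat, 'a) prods) \<le> 0" "{} = (\<lambda>_. []) ` {..<0::nat}"
    by (auto simp: slp_rules_def grammar_size_def)
  then show ?case by blast
next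
  case (rule V n \<alpha> c)
  from rule(4) obtain P val q where P0: "slp_rules P val q" "grammar_size P \<le> n" "V = val ` {..<q}"
    by blast
  then have P: "finite P" "grammar_size P \<le> n"
    "\<And>A \<alpha>. (A, \<alpha>) \<in> P \<Longrightarrow> A < q" "\<And>A \<alpha> B. (A, \<alpha>) \<in> P \<Longrightarrow> Nt B \<in> set \<alpha> \<Longrightarrow> B < A"
    "\<And>A \<alpha>. (A, \<alpha>) \<in> P \<Longrightarrow> concat (map (expand val) \<alpha>) = val A"
    "\<And>A. A < q \<Longrightarrow> \<exists>\<alpha>. (A, \<alpha>) \<in> P" "V = val ` {..<q}"
    unfolding slp_rules_def by blast+
  have "\<exists>\<beta>. length \<beta> = length \<alpha> \<and> map (expand val) \<beta> = \<alpha> \<and> (\<forall>B. Nt B \<in> set \<beta> \<longrightarrow> B < q)"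
    using rule(2)
  proof (induction \<alpha>)
    case (Cons w \<alpha>)
    then obtain \<beta> where \<beta>: "length \<beta> = length \<alpha>" "map (expand val) \<beta> = \<alpha>" "\<forall>B. Nt B \<in> set \<beta> \<longrightarrow> B < q"
      by auto
    from Cons(2) consider B where "B < q" "w = val B" | a where "w = [a]"
      using P(7) by auto
    then show ?case
    proof cases
      case 1
      then show ?thesis using \<beta> by (intro exI[of _ "Nt B # \<beta>"]) auto
    next
      case 2
      then show ?thesis using \<beta> by (intro exI[of _ "Tm a # \<beta>"]) auto
    qed
  qed simp
  then obtain \<beta> where \<beta>: "length \<beta> = length \<alpha>" "map (expand val) \<beta> = \<alpha>" "\<And>B. Nt B \<in> set \<beta> \<Longrightarrow> B < q"
    by blast
  define val' where "val' = val(q := concat \<alpha>)"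
  \<comment> \<open>\<open>val'\<close> differs from \<open>val\<close> at the fresh number
    \<open>q\<close> only, which no earlier right-hand side mentions.\<close>
  have upd: "map (expand val') \<gamma> = map (expand val) \<gamma>" if "\<And>B. Nt B \<in> set \<gamma> \<Longrightarrow> B < q" for \<gamma>
    using that by (auto simp: val'_def split: sym.splits)
  have new: "(q, \<beta>) \<notin> P" using P(3) by blast
  have old: "concat (map (expand val') \<gamma>) = val' A" if "(A, \<gamma>) \<in> P" for A \<gamma>
  proof -
    have "B < q" if "Nt B \<in> set \<gamma>" for B
      using P(3,4) that \<open>(A, \<gamma>) \<in> P\<close> by (meson less_trans)
    then have "concat (map (expand val') \<gamma>) = val A"
      using P(5)[OF that] by (simp only: upd)
    then show ?thesis using P(3)[OF that] by (simp add: val'_def)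
  qed
  have "slp_rules (insert (q, \<beta>) P) val' (Suc q)"
    unfolding slp_rules_def
  proof (intro conjI allI impI)
    fix A \<gamma> assume "(A, \<gamma>) \<in> insert (q, \<beta>) P"
    then consider "A = q" "\<gamma> = \<beta>" | "(A, \<gamma>) \<in> P" by blast
    then show "concat (map (expand val') \<gamma>) = val' A"
      by cases (simp_all add: upd[OF \<beta>(3)] \<beta>(2) old, simp add: val'_def)
  qed (use P(1,3,4,6) \<beta>(3) in \<open>auto simp: less_Suc_eq\<close>)
  moreover have "grammar_size (insert (q, \<beta>) P) \<le> n + c"
    using P(1,2) new \<beta>(1) rule(3) by (simp add: grammar_size_def)
  moreover have "insert (concat \<alpha>) V = val' ` {..<Suc q}"
    using P(7) by (auto simp: val'_def lessThan_Suc)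
  ultimately show ?case by blast
qed

lemma smallest_grammar_size_slp:
  fixes w :: "'a list"
  assumes "slp V n" "w \<in> V"
  shows "smallest_grammar_size w \<le> n"
proof -
  from slp_grammar[OF assms(1)] obtain P val q where P: "slp_rules P val q" "grammar_size P \<le> n" "V = val ` {..<q}"
    by blast
  obtain S where S: "S < q" "w = val S" using assms(2) P(3) by auto
  have "Lang P S = {val S}"
    by (rule Lang_straight_line[where N = "{..<q}" and rank = "\<lambda>x. x"])
      (use P(1) S in \<open>unfold slp_rules_def, blast, fastforce, auto\<close>)
  then have "smallest_grammar_size w \<le> grammar_size P"
    unfolding smallest_grammar_size_def using P(1) S by (intro Least_le) (auto simp: slp_rules_def)
  with P(2) show ?thesis by simp
qed

text \<open>Members may refer to earlier members, so q words built by recursion cost c symbols each,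
  whatever their lengths.\<close>

lemma slp_family:
  assumes "slp V n"
    and "\<And>i. i < q \<Longrightarrow> W i = concat (\<alpha> i)"
    and "\<And>i. i < q \<Longrightarrow> length (\<alpha> i) \<le> c"
    and "\<And>i. i < q \<Longrightarrow> set (\<alpha> i) \<subseteq> V \<union> {[a] | a. True} \<union> W ` {..<i}"
  shows "slp (V \<union> W ` {..<q}) (n + q * c)"
proof -
  have "slp (V \<union> W ` {..<j}) (n + j * c)" if "j \<le> q" for j
    using that
  proof (induction j)
    case (Suc j)
    then have "slp (V \<union> W ` {..<j}) (n + j * c)" by simp
    then have "slp (insert (concat (\<alpha> j)) (V \<union> W ` {..<j})) (n + j * c + c)"
      by (rule slp.rule) (use assms(3,4)[of j] Suc in auto)
    then show ?case using assms(2)[of j] Suc by (simp add: lessThan_Suc algebra_simps)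
  qed (simp add: assms(1))
  then show ?thesis by simp
qed

lemma slp_powers: "slp V n \<Longrightarrow> slp (V \<union> (\<lambda>i. replicate (Suc i) x) ` {..<q}) (n + q * 2)"
proof (erule slp_family[where \<alpha> = "\<lambda>i. case i of 0 \<Rightarrow> [[x]] | Suc j \<Rightarrow> [replicate i x, [x]]"])
qed (auto split: nat.splits simp: replicate_append_same)

section \<open>The preamble\<close>

text \<open>
  The letters \<open>a, b, c, d, e, f, $\<close> are the numbers \<open>0, 1, 2, 3, 4, 5, 6\<close>.
\<close>

lemma prefix_run [simp]:
  assumes "y \<noteq> x" "z \<noteq> x"
  shows "prefix (replicate i x @ y # w) (replicate j x @ z # w') \<longleftrightarrow> i = j \<and> y = z \<and> prefix w w'"
proof (induction i arbitrary: j)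
  case 0 then show ?case using assms by (cases j) auto
next
  case (Suc i) then show ?case using assms by (cases j) auto
qed

definition e_word :: "nat \<Rightarrow> nat list" where "e_word j = replicate j 4 @ [2]"
definition f_word :: "nat \<Rightarrow> nat list" where "f_word j = replicate j 3 @ [5]"

text \<open>
  The words \<open>e\<^sup>j c\<close> will serve as separators. They are interleaved with the chain \<open>d\<^sup>j f\<close>, since otherwise LZMW
  would learn \<open>e\<^sup>j c e\<close>, which is longer than the separator \<open>e\<^sup>j c\<close> in \<open>e\<^sup>j c e\<^sup>j c\<close>.
\<close>

definition chain :: "nat \<Rightarrow> (nat list \<times> nat list) list" where
  "chain j = [([4], e_word j), ([3], f_word j)]"

definition chain_L :: "nat \<Rightarrow> nat list set" where
  "chain_L i = {[a] | a. a \<le> 6} \<union> e_word ` {..i} \<union> f_word ` {..i}"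

text \<open>The word \<open>[4]\<close> is \<open>[] @ [4]\<close>, recorded by the very first
  factor. The last family consists of LZMW words across two consecutive chain steps; its member with
  j = i - 1 arises only in step i and is included early, so that recording it leaves the bound
  unchanged.\<close>

definition chain_P :: "nat \<Rightarrow> nat list set" where
  "chain_P i = {[4]} \<union> e_word ` {..i} \<union> f_word ` {..i} \<union> (\<lambda>j. e_word j @ [3]) ` {..<i} \<union> (\<lambda>j. f_word j @ [4]) ` {..<i}"

lemma e_word_Suc: "e_word (Suc j) = 4 # e_word j" and f_word_Suc: "f_word (Suc j) = 3 # f_word j"
  by (simp_all add: e_word_def f_word_def)

lemma prefix_E [simp]: "z \<noteq> 4 \<Longrightarrow> prefix (e_word i @ w) (replicate j 4 @ z # w') \<longleftrightarrow> i = j \<and> z = 2 \<and> prefix w w'"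
  "prefix (e_word i @ w) (e_word j @ w') \<longleftrightarrow> i = j \<and> prefix w w'"
  "prefix (e_word i) (e_word j @ w') \<longleftrightarrow> i = j"
  "prefix (f_word i @ w) (f_word j @ w') \<longleftrightarrow> i = j \<and> prefix w w'"
  "prefix (f_word i) (f_word j @ w') \<longleftrightarrow> i = j"
  by (auto simp: e_word_def f_word_def)

lemma prefix_EF [simp]:
  "\<not> prefix (e_word i @ w) (f_word j @ w')" "\<not> prefix (f_word i @ w) (e_word j @ w')"
  "\<not> prefix (e_word i) (f_word j @ w')" "\<not> prefix (f_word i) (e_word j @ w')"
  by (cases i; cases j; simp add: e_word_def f_word_def)+

lemma length_EF [simp]: "length (e_word i) = Suc i" "length (f_word i) = Suc i"
  by (simp_all add: e_word_def f_word_def)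

text \<open>A known word e^j c can match e^(i+1) c only if the runs agree, but only j \<le> i has
  been learnt; hence the first factor is the single letter e. The second factor e^i c is followed by
  d here for the first time. The chain of d and f behaves alike.\<close>

lemma chain_step:
  "parses (chain_L i) (chain_P i) (if i = 0 then [] else f_word (i - 1)) (chain i) R
   (chain_L (Suc i)) (chain_P (Suc i)) (f_word i)"
proof -
  have L: "[4] \<in> chain_L i" "[3] \<in> chain_L i" "e_word i \<in> chain_L i" "f_word i \<in> chain_L i"
    by (auto simp: chain_L_def)
  have l: "insert ((if i = 0 then [] else f_word (i - 1)) @ [4]) (chain_P i) = chain_P i"
    by (cases i) (auto simp: chain_P_def)
  have P: "short_prefixes (chain_P i) (e_word (Suc i) @ w) [4]"
     "short_prefixes (chain_P i) (e_word i @ 3 # w) (e_word i)"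
     "short_prefixes (insert (e_word (Suc i)) (chain_P i)) (f_word (Suc i) @ w) [3]"
     "short_prefixes (insert (e_word i @ [3]) (insert (e_word (Suc i)) (chain_P i))) (f_word i @ w) (f_word i)" for w
    by (auto simp: chain_P_def short_prefixes_def)
  have ex: "insert (f_word (Suc i)) (insert (e_word (Suc i)) (chain_L i)) = chain_L (Suc i)"
    "insert (f_word (Suc i)) (insert (e_word i @ [3]) (insert (e_word (Suc i)) (chain_P i))) \<subseteq> chain_P (Suc i)"
    by (auto simp: chain_L_def chain_P_def atMost_Suc)
  show ?thesis
    unfolding chain_def parses.simps l
    using P(1)[of "f_word (Suc i) @ R"] P(2)[of "f_word i @ R"] P(3)[of R] P(4)[of R] ex L
    by (simp add: e_word_Suc f_word_Suc)
qed

lemma chain_parses: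
  assumes "n > 0"
  shows "parses {[a] | a. a \<le> 6} {} [] (concat (map chain [0..<n])) r (chain_L n) (chain_P n) (f_word (n - 1))"
proof -
  let ?l = "\<lambda>i. if i = 0 then [] else f_word (i - 1)"
  have "parses (chain_L 0) (chain_P 0) (?l 0) (concat (map chain [0..<n])) (remaining chain n r n)
     (chain_L n) (chain_P n) (?l n)"
    by (rule parses_loop[where l = ?l]) (use chain_step in \<open>auto simp: remaining_step\<close>)
  then have "parses (chain_L 0) (chain_P 0) [] (concat (map chain [0..<n])) r (chain_L n) (chain_P n) (f_word (n - 1))"
    using assms by simp
  then show ?thesis
    by (rule parses_weaken) (auto simp: chain_L_def e_word_def f_word_def)
qed

section \<open>Insertion of binary words between separators\<close>

lemma prefix_barrier:
  assumes "set x \<subseteq> A" "z \<notin> A" "prefix x (y @ z # w)"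
  shows "prefix x y"
proof -
  have "\<not> length x > length y"
  proof
    assume l: "length x > length y"
    have "x ! length y = z"
      using assms(3) l by (auto simp: prefix_def nth_append append_eq_append_conv2 Cons_eq_append_conv)
    then show False using assms l nth_mem[OF l] by auto
  qed
  then show ?thesis using assms(3) by (meson linorder_not_less prefix_length_prefix prefixI)
qed

lemma prefix_barrier_eq:
  assumes "set x \<subseteq> A" "set y \<subseteq> A" "z \<notin> A" "z' \<notin> A" "prefix (x @ z' # w') (y @ z # w)"
  shows "x = y \<and> prefix (z' # w') (z # w)"
proof -
  have "prefix x (y @ z # w)" using assms(5) by (meson append_prefixD)
  then have "prefix x y" by (rule prefix_barrier[OF assms(1,3)])
  then obtain r where r: "y = x @ r" by (auto simp: prefix_def)
  have "r = []"
  proof (cases r)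
    case (Cons a r')
    then show ?thesis using assms r by simp
  qed
  then show ?thesis using r assms(5) by simp
qed

lemma e_word_Cons: "\<exists>w. e_word i = (if i = 0 then 2 else 4) # w"
  by (cases i) (auto simp: e_word_def)

text \<open>
  Since each insertion has its own separator, no word straddling it can reappear later.
\<close>

definition insertion :: "(nat \<Rightarrow> nat list) \<Rightarrow> (nat \<Rightarrow> nat list) \<Rightarrow> nat \<Rightarrow> nat \<Rightarrow> (nat list \<times> nat list) list" where
  "insertion u v M i = [(u i, v i), (e_word (M - i), e_word (M - i))]"

definition insertion_P :: "(nat \<Rightarrow> nat list) \<Rightarrow> (nat \<Rightarrow> nat list) \<Rightarrow> nat \<Rightarrow> nat \<Rightarrow> nat list set" where
  "insertion_P u v M i = chain_P M \<union> {f_word (M - 1) @ u 0} \<union> (\<lambda>j. u j @ v j) ` {..<i} \<union>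
     (\<lambda>j. v j @ e_word (M - j)) ` {..<i} \<union> (\<lambda>j. e_word (M - j) @ e_word (M - j)) ` {..<i} \<union>
     (\<lambda>j. e_word (M - j) @ u (Suc j)) ` {..<i}"

lemma not_prefix_EF:
  assumes "a \<in> {0, 1}"
  shows "\<not> prefix (e_word j @ w) (a # y)" "\<not> prefix (e_word j) (a # y)" "\<not> prefix (f_word j @ w) (a # y)" "\<not> prefix (f_word j) (a # y)"
  using assms by (cases j; auto simp: e_word_def f_word_def)+

text \<open>A recorded word reaching from \<open>v j\<close> into its separator cannot match,
  because \<open>e_word (M - j)\<close> and \<open>e_word (M - i)\<close> differ for j < i. Inside
  \<open>u i @ v i\<close> only letters and earlier inserted words remain, and \<open>short\<close>
  controls the latter. At a separator the only threat is \<open>e_word (M - i) @ [3]\<close> from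
  the chain, but the next letter is e or, by \<open>R\<close>, the letter a.\<close>

lemma insertion_step:
  assumes i: "i < M"
    and bin: "\<And>j. j < M \<Longrightarrow> set (u j) \<subseteq> {0, 1} \<and> set (v j) \<subseteq> {0, 1} \<and> u j \<noteq> [] \<and> v j \<noteq> []"
    and short: "\<And>j. j < i \<Longrightarrow> prefix (u j @ v j) (u i @ v i) \<Longrightarrow> length (u j @ v j) \<le> length (u i)"
    and dict: "u i \<in> chain_L M \<union> (\<lambda>j. u j @ v j) ` {..<i}" "v i \<in> chain_L M \<union> (\<lambda>j. u j @ v j) ` {..<i}"
    and R: "R = 0 # R'"
  shows "parses (chain_L M \<union> (\<lambda>j. u j @ v j) ` {..<i}) (insertion_P u v M i)
     (if i = 0 then f_word (M - 1) else e_word (M - (i - 1)))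
     (insertion u v M i) R
     (chain_L M \<union> (\<lambda>j. u j @ v j) ` {..<Suc i}) (insertion_P u v M (Suc i)) (e_word (M - i))"
proof -
  let ?L = "chain_L M \<union> (\<lambda>j. u j @ v j) ` {..<i}"
  let ?P = "insertion_P u v M i"
  let ?e_word = "e_word (M - i)"
  have l: "insert ((if i = 0 then f_word (M - 1) else e_word (M - (i - 1))) @ u i) ?P = ?P"
  proof (rule insert_absorb)
    show "(if i = 0 then f_word (M - 1) else e_word (M - (i - 1))) @ u i \<in> ?P"
    proof (cases i)
      case (Suc j)
      then have "e_word (M - j) @ u (Suc j) \<in> (\<lambda>j. e_word (M - j) @ u (Suc j)) ` {..<i}" by blast
      then show ?thesis using Suc by (simp add: insertion_P_def)
    qed (simp add: insertion_P_def)
  qed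
  obtain z e where ze: "?e_word = z # e" "z \<notin> {0, 1}" "z = 4" using e_word_Cons[of "M - i"] i by auto
  have hd_E: "\<not> prefix (e_word j @ w) y" "\<not> prefix (e_word j) y" "\<not> prefix (f_word j @ w) y" "\<not> prefix (f_word j) y"
    if "y = a # y'" "a \<in> {0, 1}" for a y y' w j
    unfolding that(1) using that(2) by (rule not_prefix_EF)+
  have hd_ui: "\<exists>a y'. u i = a # y' \<and> a \<in> {0, 1}" and hd_vi: "\<exists>a y'. v i = a # y' \<and> a \<in> {0, 1}"
    using bin[OF i] by (cases "u i"; cases "v i"; auto)+
  have no_sep: "\<not> prefix (v j @ e_word (M - j)) (y @ ?e_word @ w)" if "j < i" "set y \<subseteq> {0, 1}" for j y w
  proof
    assume p: "prefix (v j @ e_word (M - j)) (y @ ?e_word @ w)"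
    obtain z' e' where ze': "e_word (M - j) = z' # e'" "z' \<notin> {0, 1}" using e_word_Cons[of "M - j"] by force
    have "prefix (z' # e') (z # e @ w)"
      using p prefix_barrier_eq[of "v j" "{0, 1}" y z z' e' "e @ w"] ze ze' bin[of j] that i by auto
    then have "prefix (e_word (M - j)) (?e_word @ w)" using ze ze' by simp
    then show False using that i by simp
  qed
  have bar: "prefix (u j @ v j) y" if "j < i" "prefix (u j @ v j) (y @ ?e_word @ w)" for j y w
    using prefix_barrier[of "u j @ v j" "{0, 1}" z y "e @ w"] that bin[of j] i ze by simp
  have hd_v: "\<not> prefix (v j @ x) (?e_word @ w)" "\<not> prefix (u j @ x) (?e_word @ w)" if "j \<le> i" for j w x
    using ze bin[of j] that i by (cases "v j"; cases "u j"; auto)+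
  have chain_bin: "length x \<le> 1" if "x \<in> chain_P M" "prefix x y" "y = a # y'" "a \<in> {0, 1}" for x y a y'
    using that(1,2) hd_E[OF that(3,4)] that(3,4) by (auto simp: chain_P_def)
  have chain_E: "length x \<le> length ?e_word" if "x \<in> chain_P M" "prefix x (?e_word @ w)" "prefix [3] w \<Longrightarrow> False" for x w
    using that i by (auto simp: chain_P_def)
  have 1: "short_prefixes ?P (u i @ v i @ ?e_word @ w) (u i)" for w
    unfolding short_prefixes_def
  proof (intro ballI impI)
    fix x assume x: "x \<in> ?P" "prefix x (u i @ v i @ ?e_word @ w)"
    obtain a y' where a: "u i = a # y'" "a \<in> {0, 1}" using hd_ui by blast
    have b: "u i @ v i @ ?e_word @ w = a # y' @ v i @ ?e_word @ w" by (simp add: a)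
    from x consider "x \<in> chain_P M" | j where "x = u j @ v j" "j < i"
      using hd_E[OF b a(2)] no_sep[of _ "u i @ v i" w] bin[OF i] by (auto simp: insertion_P_def)
    then show "length x \<le> length (u i)"
    proof cases
      case 1
      then show ?thesis using chain_bin[OF _ x(2) b a(2)] by (simp add: a)
    next
      case 2
      then show ?thesis using short[of j] bar[of j "u i @ v i" w] x by auto
    qed
  qed
  have 2: "short_prefixes ?P (v i @ ?e_word @ w) (v i)" for w
    unfolding short_prefixes_def
  proof (intro ballI impI)
    fix x assume x: "x \<in> ?P" "prefix x (v i @ ?e_word @ w)"
    obtain a y' where a: "v i = a # y'" "a \<in> {0, 1}" using hd_vi by blast
    have b: "v i @ ?e_word @ w = a # y' @ ?e_word @ w" by (simp add: a)
    from x consider "x \<in> chain_P M" | j where "x = u j @ v j" "j < i"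
      using hd_E[OF b a(2)] no_sep[of _ "v i" w] bin[OF i] by (auto simp: insertion_P_def)
    then show "length x \<le> length (v i)"
    proof cases
      case 1
      then show ?thesis using chain_bin[OF _ x(2) b a(2)] by (simp add: a)
    next
      case 2
      then show ?thesis using bar[of j "v i" w] x prefix_length_le[of x "v i"] by auto
    qed
  qed
  have E34: "\<not> prefix [3] (?e_word @ w)" "\<not> prefix [3] R" for w using ze R by auto
  have 3: "short_prefixes (insert (u i @ v i) ?P) (?e_word @ ?e_word @ R) ?e_word"
    unfolding short_prefixes_def
  proof (intro ballI impI)
    fix x assume x: "x \<in> insert (u i @ v i) ?P" "prefix x (?e_word @ ?e_word @ R)"
    then have "x \<in> chain_P M"
      using hd_v i by (auto simp: insertion_P_def)
    then show "length x \<le> length ?e_word" using chain_E[OF _ x(2)] E34 by blast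
  qed
  have 4: "short_prefixes (insert (v i @ ?e_word) (insert (u i @ v i) ?P)) (?e_word @ R) ?e_word"
    unfolding short_prefixes_def
  proof (intro ballI impI)
    fix x assume x: "x \<in> insert (v i @ ?e_word) (insert (u i @ v i) ?P)" "prefix x (?e_word @ R)"
    then have "x \<in> chain_P M"
      using hd_v i by (auto simp: insertion_P_def)
    then show "length x \<le> length ?e_word" using chain_E[OF _ x(2)] E34 by blast
  qed
  have EL: "?e_word \<in> chain_L M" by (auto simp: chain_L_def)
  have ex: "chain_L M \<union> (\<lambda>j. u j @ v j) ` {..<Suc i} \<subseteq> insert (?e_word @ ?e_word) (insert (u i @ v i) ?L)"
    by (auto simp: lessThan_Suc)
  have ex': "insert (?e_word @ ?e_word) (insert (v i @ ?e_word) (insert (u i @ v i) ?P)) \<subseteq> insertion_P u v M (Suc i)"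
    unfolding insertion_P_def lessThan_Suc image_insert by blast
  show ?thesis
    unfolding insertion_def parses.simps l
    using 1[of "?e_word @ R"] 2[of "?e_word @ R"] 3 4 dict EL ex ex'
    by simp
qed

lemma insertion_parses:
  assumes M: "0 < M"
    and bin: "\<And>j. j < M \<Longrightarrow> set (u j) \<subseteq> {0, 1} \<and> set (v j) \<subseteq> {0, 1} \<and> u j \<noteq> [] \<and> v j \<noteq> []"
    and zero: "\<And>j. j < M \<Longrightarrow> hd (u j) = 0"
    and short: "\<And>i j. i < M \<Longrightarrow> j < i \<Longrightarrow> prefix (u j @ v j) (u i @ v i) \<Longrightarrow> length (u j @ v j) \<le> length (u i)"
    and dict: "\<And>i. i < M \<Longrightarrow> u i \<in> chain_L M \<union> (\<lambda>j. u j @ v j) ` {..<i}"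
      "\<And>i. i < M \<Longrightarrow> v i \<in> chain_L M \<union> (\<lambda>j. u j @ v j) ` {..<i}"
    and R: "R = 0 # R'"
  shows "parses (chain_L M) (chain_P M) (f_word (M - 1)) (concat (map (insertion u v M) [0..<M])) R
     (chain_L M \<union> (\<lambda>j. u j @ v j) ` {..<M}) (insertion_P u v M M) (e_word 1)"
proof -
  let ?L = "\<lambda>i. chain_L M \<union> (\<lambda>j. u j @ v j) ` {..<i}" and ?P = "insertion_P u v M"
  let ?l = "\<lambda>i. if i = 0 then f_word (M - 1) else e_word (M - (i - 1))"
  let ?R = "remaining (insertion u v M) M R"
  have "parses (?L 0) (?P 0) (?l 0) (concat (map (insertion u v M) [0..<M])) (?R M) (?L M) (?P M) (?l M)"
  proof (rule parses_loop[where L = ?L and P = ?P and l = ?l and R = ?R])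
    fix i assume i: "i < M"
    have "\<exists>R'. ?R (Suc i) = 0 # R'"
    proof (cases "Suc i < M")
      case True
      then obtain x where "u (Suc i) = 0 # x" using bin zero by (metis list.collapse)
      then show ?thesis using True by (simp add: remaining_step insertion_def)
    next
      case False
      then have "Suc i = M" using i by simp
      then show ?thesis using R by simp
    qed
    then obtain R' where R': "?R (Suc i) = 0 # R'" by blast
    have l: "?l (Suc i) = e_word (M - i)" by simp
    show "parses (?L i) (?P i) (?l i) (insertion u v M i) (?R (Suc i)) (?L (Suc i)) (?P (Suc i)) (?l (Suc i))"
      unfolding l by (rule insertion_step[OF i bin short[OF i] dict[OF i] R'])
  qed (simp add: remaining_step)
  moreover have "M - (M - 1) = 1" using M by simp
  ultimately have "parses (?L 0) (?P 0) (f_word (M - 1)) (concat (map (insertion u v M) [0..<M])) R (?L M) (?P M) (e_word 1)"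
    using M by simp
  then show ?thesis
    by (rule parses_weaken) (auto simp: insertion_P_def)
qed

section \<open>The concrete insertions\<close>

abbreviation (input) zeros :: "nat \<Rightarrow> nat list" where "zeros i \<equiv> replicate i 0"

text \<open>
  The inserted pairs are \<open>(a\<^sup>p, a)\<close> for \<open>1 \<le> p < k\<close>, \<open>(a\<^sup>p, b)\<close> for \<open>1 \<le> p \<le> k\<close> and \<open>(a\<^sup>p b, a\<^sup>k\<^sup>-\<^sup>p)\<close> for \<open>1 \<le> p < k\<close>, in this order.
\<close>

definition ins_fst :: "nat \<Rightarrow> nat \<Rightarrow> nat list" where
  "ins_fst k i = (if i < k - 1 then zeros (i + 1) else if i < 2 * k - 1 then zeros (i + 2 - k)
     else zeros (i + 2 - 2 * k) @ [1])"

definition ins_snd :: "nat \<Rightarrow> nat \<Rightarrow> nat list" where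
  "ins_snd k i = (if i < k - 1 then [0] else if i < 2 * k - 1 then [1] else zeros (3 * k - 2 - i))"

text \<open>The three blocks have k - 1, k and k - 1 members, whence the total 3k - 2; in each block
  the exponent p is recovered from the index.\<close>

lemma ins_cases:
  assumes "i < 3 * k - 2"
  obtains p where "1 \<le> p" "p < k" "i = p - 1" "ins_fst k i = zeros p" "ins_snd k i = [0]"
  | p where "1 \<le> p" "p \<le> k" "i = p + k - 2" "ins_fst k i = zeros p" "ins_snd k i = [1]"
  | p where "1 \<le> p" "p < k" "i = p + 2 * k - 2" "ins_fst k i = zeros p @ [1]" "ins_snd k i = zeros (k - p)"
proof -
  consider "i < k - 1" | "k - 1 \<le> i" "i < 2 * k - 1" | "2 * k - 1 \<le> i" by linarith
  then show thesis
  proof cases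
    case 1
    then show thesis by (intro that(1)[of "i + 1"]) (auto simp: ins_fst_def ins_snd_def)
  next
    case 2
    then show thesis using assms by (intro that(2)[of "i + 2 - k"]) (auto simp: ins_fst_def ins_snd_def)
  next
    case 3
    have "3 * k - 2 - i = k - (i + 2 - 2 * k)" using 3 assms by linarith
    then show thesis using 3 assms by (intro that(3)[of "i + 2 - 2 * k"]) (auto simp: ins_fst_def ins_snd_def)
  qed
qed

lemma prefix_zeros [simp]:
  assumes "z \<noteq> 0"
  shows "prefix (zeros p) (zeros q @ z # w) \<longleftrightarrow> p \<le> q"
    and "\<not> prefix (zeros p @ z # w) (zeros q)"
proof -
  show "prefix (zeros p) (zeros q @ z # w) \<longleftrightarrow> p \<le> q"
  proof (induction p arbitrary: q)
    case (Suc p)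
    then show ?case using assms by (cases q) auto
  qed simp
  show "\<not> prefix (zeros p @ z # w) (zeros q)"
    using set_mono_prefix[of "zeros p @ z # w" "zeros q"] assms by (auto split: if_splits)
qed

lemma prefix_zeros_zeros [simp]: "prefix (zeros p) (zeros q) \<longleftrightarrow> p \<le> q"
proof
  assume "p \<le> q"
  then have "zeros q = zeros p @ zeros (q - p)" by (simp flip: replicate_add)
  then show "prefix (zeros p) (zeros q)" by simp
qed (auto dest: prefix_length_le)

lemma ins_phrase:
  assumes "1 \<le> p"
  shows "p < k \<Longrightarrow> ins_fst k (p - 1) @ ins_snd k (p - 1) = zeros (Suc p)"
    and "p \<le> k \<Longrightarrow> ins_fst k (p + k - 2) @ ins_snd k (p + k - 2) = zeros p @ [1]"
    and "p < k \<Longrightarrow> ins_fst k (p + 2 * k - 2) @ ins_snd k (p + 2 * k - 2) = zeros p @ 1 # zeros (k - p)"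
proof -
  show "p < k \<Longrightarrow> ins_fst k (p - 1) @ ins_snd k (p - 1) = zeros (Suc p)"
    using assms by (simp add: ins_fst_def ins_snd_def replicate_append_same)
  show "p \<le> k \<Longrightarrow> ins_fst k (p + k - 2) @ ins_snd k (p + k - 2) = zeros p @ [1]"
    using assms by (auto simp: ins_fst_def ins_snd_def)
  assume p: "p < k"
  then have "3 * k - 2 - (p + 2 * k - 2) = k - p" "p + 2 * k - 2 + 2 - 2 * k = p" using assms by linarith+
  then show "ins_fst k (p + 2 * k - 2) @ ins_snd k (p + 2 * k - 2) = zeros p @ 1 # zeros (k - p)"
    using assms p by (auto simp: ins_fst_def ins_snd_def)
qed

text \<open>Matching words agree in the run before the letter b. So an earlier word that matches is
  a power a^q with q \<le> p or, in the third block, a^p b, which is exactly the first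
  factor.\<close>

lemma ins_short:
  assumes "i < 3 * k - 2" "j < i" "prefix (ins_fst k j @ ins_snd k j) (ins_fst k i @ ins_snd k i)"
  shows "length (ins_fst k j @ ins_snd k j) \<le> length (ins_fst k i)"
proof -
  have j: "j < 3 * k - 2" using assms by linarith
  have z: "zeros p @ [0] = zeros (Suc p)" for p by (simp add: replicate_append_same)
  from ins_cases[OF assms(1)] show ?thesis
  proof cases
    case p: (1 p)
    from ins_cases[OF j] show ?thesis
    proof cases
      case (1 q)
      then show ?thesis using p assms(2) by simp
    qed (use p assms(2) in linarith)+
  next
    case p: (2 p)
    from ins_cases[OF j] show ?thesis
    proof cases
      case (1 q)
      then show ?thesis using p assms(3) by (simp add: z del: replicate_Suc prefix_snoc)
    next
      case (2 q)
      then show ?thesis using p assms(2,3) by simp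
    qed (use p assms(2) in linarith)
  next
    case p: (3 p)
    from ins_cases[OF j] show ?thesis
    proof cases
      case (1 q)
      then show ?thesis using p assms(3) by (simp add: z del: replicate_Suc prefix_snoc)
    next
      case (2 q)
      then show ?thesis using p assms(3) by simp
    next
      case (3 q)
      then show ?thesis using p assms(2,3) by simp
    qed
  qed
qed

definition ins_words :: "nat \<Rightarrow> nat list set" where
  "ins_words k = (\<lambda>p. zeros p) ` {2..k} \<union> (\<lambda>p. zeros p @ [1]) ` {1..k} \<union>
     (\<lambda>p. zeros p @ 1 # zeros (k - p)) ` {1..<k}"

lemma ins_phrases_subset: "(\<lambda>j. ins_fst k j @ ins_snd k j) ` {..<3 * k - 2} \<subseteq> ins_words k"
proof
  fix w assume "w \<in> (\<lambda>j. ins_fst k j @ ins_snd k j) ` {..<3 * k - 2}"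
  then obtain i where i: "i < 3 * k - 2" "w = ins_fst k i @ ins_snd k i" by auto
  from ins_cases[OF i(1)] show "w \<in> ins_words k"
  proof cases
    case (1 p)
    then have "w = zeros (Suc p)" "Suc p \<in> {2..k}" using i by (auto simp: replicate_append_same)
    then show ?thesis unfolding ins_words_def by blast
  next
    case (2 p)
    then have "w = zeros p @ [1]" "p \<in> {1..k}" using i by auto
    then show ?thesis unfolding ins_words_def by blast
  next
    case (3 p)
    then have "w = zeros p @ 1 # zeros (k - p)" "p \<in> {1..<k}" using i by auto
    then show ?thesis unfolding ins_words_def by blast
  qed
qed

lemma ins_phrases_mem:
  "2 \<le> p \<Longrightarrow> p \<le> k \<Longrightarrow> p - 2 < i \<Longrightarrow> zeros p \<in> (\<lambda>j. ins_fst k j @ ins_snd k j) ` {..<i}"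
  "1 \<le> p \<Longrightarrow> p \<le> k \<Longrightarrow> p + k - 2 < i \<Longrightarrow> zeros p @ [1] \<in> (\<lambda>j. ins_fst k j @ ins_snd k j) ` {..<i}"
  "1 \<le> p \<Longrightarrow> p < k \<Longrightarrow> p + 2 * k - 2 < i \<Longrightarrow> zeros p @ 1 # zeros (k - p) \<in> (\<lambda>j. ins_fst k j @ ins_snd k j) ` {..<i}"
proof -
  assume p: "2 \<le> p" "p \<le> k" "p - 2 < i"
  then have "zeros p = ins_fst k (p - 2) @ ins_snd k (p - 2)"
    using ins_phrase(1)[of "p - 1" k] by (simp add: numeral_2_eq_2 Suc_diff_Suc del: replicate_Suc)
  then show "zeros p \<in> (\<lambda>j. ins_fst k j @ ins_snd k j) ` {..<i}" using p(3) by (intro image_eqI[where x = "p - 2"]) simp_all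
next
  assume p: "1 \<le> p" "p \<le> k" "p + k - 2 < i"
  then show "zeros p @ [1] \<in> (\<lambda>j. ins_fst k j @ ins_snd k j) ` {..<i}"
    using ins_phrase(2)[OF p(1,2)] by (intro image_eqI[where x = "p + k - 2"]) simp_all
next
  assume p: "1 \<le> p" "p < k" "p + 2 * k - 2 < i"
  then show "zeros p @ 1 # zeros (k - p) \<in> (\<lambda>j. ins_fst k j @ ins_snd k j) ` {..<i}"
    using ins_phrase(3)[OF p(1,2)] by (intro image_eqI[where x = "p + 2 * k - 2"]) simp_all
qed

lemma ins_parses:
  assumes k: "2 \<le> k" and R: "R = 0 # R'"
  defines "M \<equiv> 3 * k - 2"
  shows "parses (chain_L M) (chain_P M) (f_word (M - 1)) (concat (map (insertion (ins_fst k) (ins_snd k) M) [0..<M])) R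
     (chain_L M \<union> (\<lambda>j. ins_fst k j @ ins_snd k j) ` {..<M}) (insertion_P (ins_fst k) (ins_snd k) M M) (e_word 1)"
proof (rule insertion_parses[OF _ _ _ _ _ _ R])
  show "0 < M" using k by (simp add: M_def)
next
  fix i assume "i < M"
  then have i: "i < 3 * k - 2" by (simp add: M_def)
  have l: "[0] \<in> chain_L M" "[1] \<in> chain_L M" by (auto simp: chain_L_def)
  show "set (ins_fst k i) \<subseteq> {0, 1} \<and> set (ins_snd k i) \<subseteq> {0, 1} \<and> ins_fst k i \<noteq> [] \<and> ins_snd k i \<noteq> []"
    by (rule ins_cases[OF i]) auto
  show "hd (ins_fst k i) = 0"
    by (rule ins_cases[OF i]) auto
  show "length (ins_fst k j @ ins_snd k j) \<le> length (ins_fst k i)"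
    if "j < i" "prefix (ins_fst k j @ ins_snd k j) (ins_fst k i @ ins_snd k i)" for j
    by (rule ins_short[OF i that])
  have z: "zeros p \<in> chain_L M \<union> (\<lambda>j. ins_fst k j @ ins_snd k j) ` {..<i}" if "1 \<le> p" "p \<le> k" "p \<le> i + 1" for p
  proof (cases "p = 1")
    case True
    then show ?thesis using l by simp
  next
    case False
    then have "2 \<le> p" "p - 2 < i" using that by auto
    then show ?thesis using ins_phrases_mem(1)[of p k i] that by blast
  qed
  show "ins_fst k i \<in> chain_L M \<union> (\<lambda>j. ins_fst k j @ ins_snd k j) ` {..<i}"
  proof (rule ins_cases[OF i])
    fix p assume p: "1 \<le> p" "p < k" "i = p + 2 * k - 2" "ins_fst k i = zeros p @ [1]"
    then have "p + k - 2 < i" by linarith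
    then show ?thesis using ins_phrases_mem(2)[of p k i] p by simp
  next
    fix p assume p: "1 \<le> p" "p < k" "i = p - 1" "ins_fst k i = zeros p"
    show ?thesis unfolding p(4) by (rule z) (use p in auto)
  next
    fix p assume p: "1 \<le> p" "p \<le> k" "i = p + k - 2" "ins_fst k i = zeros p"
    show ?thesis unfolding p(4) by (rule z) (use p k in auto)
  qed
  show "ins_snd k i \<in> chain_L M \<union> (\<lambda>j. ins_fst k j @ ins_snd k j) ` {..<i}"
  proof (rule ins_cases[OF i])
    fix p assume p: "1 \<le> p" "p < k" "i = p + 2 * k - 2" "ins_snd k i = zeros (k - p)"
    show ?thesis unfolding p(4) by (rule z) (use p in auto)
  qed (use l in simp_all)
qed

definition delta :: "nat \<Rightarrow> nat \<Rightarrow> nat list" where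
  "delta k j = zeros j @ 1 # zeros (k - j)"

definition base_P :: "nat \<Rightarrow> nat list set" where
  "base_P k = {w. set w \<inter> {2, 3, 5} \<noteq> {}} \<union> {[4]} \<union> {zeros j | j. j \<le> k} \<union> {zeros i @ 1 # zeros l | i l. i + l \<le> k}"

lemma insertion_P_base: "insertion_P (ins_fst k) (ins_snd k) (3 * k - 2) (3 * k - 2) \<subseteq> base_P k"
proof -
  have EF: "2 \<in> set (e_word i)" "5 \<in> set (f_word i)" for i by (simp_all add: e_word_def f_word_def)
  have 1: "ins_words k \<subseteq> base_P k"
  proof
    fix w assume "w \<in> ins_words k"
    then consider p where "w = zeros p" "p \<le> k" | p where "w = zeros p @ 1 # zeros 0" "p + 0 \<le> k"
      | p where "w = zeros p @ 1 # zeros (k - p)" "p + (k - p) \<le> k"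
      by (auto simp: ins_words_def)
    then show "w \<in> base_P k"
      unfolding base_P_def by cases blast+
  qed
  have 2: "{w. set w \<inter> {2, 3, 5} \<noteq> {}} \<subseteq> base_P k" "{[4]} \<subseteq> base_P k" by (auto simp: base_P_def)
  have 3: "insertion_P (ins_fst k) (ins_snd k) (3 * k - 2) (3 * k - 2) \<subseteq>
    (\<lambda>j. ins_fst k j @ ins_snd k j) ` {..<3 * k - 2} \<union> {[4]} \<union> {w. set w \<inter> {2, 3, 5} \<noteq> {}}"
    using EF by (auto simp: insertion_P_def chain_P_def)
  show ?thesis
    by (rule order_trans[OF 3]) (intro Un_least order_trans[OF ins_phrases_subset 1] 2)
qed

lemma chain_ins_parses:
  assumes k: "2 \<le> k" and R: "R = 0 # R'"
  defines "M \<equiv> 3 * k - 2"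
  shows "parses {[a] | a. a \<le> 6} {} [] (concat (map chain [0..<M]) @
      concat (map (insertion (ins_fst k) (ins_snd k) M) [0..<M])) R
     ({[4], [6], zeros k} \<union> delta k ` {1..k}) (base_P k) (e_word 1)"
proof (rule parses_append)
  show "parses {[a] | a. a \<le> 6} {} [] (concat (map chain [0..<M])) 
     (concat (phrases (concat (map (insertion (ins_fst k) (ins_snd k) M) [0..<M]))) @ R) (chain_L M) (chain_P M) (f_word (M - 1))"
    by (rule chain_parses) (use k in \<open>simp add: M_def\<close>)
  have "zeros k \<in> (\<lambda>j. ins_fst k j @ ins_snd k j) ` {..<M}"
    by (rule ins_phrases_mem(1)) (use k in \<open>auto simp: M_def\<close>)
  moreover have "delta k p \<in> (\<lambda>j. ins_fst k j @ ins_snd k j) ` {..<M}" if "p \<in> {1..k}" for p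
  proof (cases "p = k")
    case True
    have "zeros k @ [1] \<in> (\<lambda>j. ins_fst k j @ ins_snd k j) ` {..<M}"
      by (rule ins_phrases_mem(2)) (use k in \<open>auto simp: M_def\<close>)
    then show ?thesis by (simp add: delta_def True)
  next
    case False
    show ?thesis unfolding delta_def
      by (rule ins_phrases_mem(3)) (use k False that in \<open>auto simp: M_def\<close>)
  qed
  moreover have "[4] \<in> chain_L M" "[6] \<in> chain_L M" by (auto simp: chain_L_def)
  ultimately have sub: "{[4], [6], zeros k} \<union> delta k ` {1..k} \<subseteq> chain_L M \<union> (\<lambda>j. ins_fst k j @ ins_snd k j) ` {..<M}"
    by auto
  have "parses (chain_L M) (chain_P M) (f_word (M - 1)) (concat (map (insertion (ins_fst k) (ins_snd k) M) [0..<M]) @ []) R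
     ({[4], [6], zeros k} \<union> delta k ` {1..k}) (base_P k) (e_word 1)"
    by (rule parses_append)
      (use ins_parses[OF k, of "concat (phrases []) @ R"] R sub insertion_P_base[of k] in \<open>auto simp: M_def\<close>)
  then show "parses (chain_L M) (chain_P M) (f_word (M - 1)) (concat (map (insertion (ins_fst k) (ins_snd k) M) [0..<M])) R
     ({[4], [6], zeros k} \<union> delta k ` {1..k}) (base_P k) (e_word 1)" by simp
qed

section \<open>The rounds\<close>

lemma zeros_append: "a + b = q \<Longrightarrow> zeros a @ zeros b @ w = zeros q @ w"
  by (auto simp: replicate_add)

lemma delta_append_delta: "k - j + l = q \<Longrightarrow> delta k j @ delta k l @ w = zeros j @ 1 # zeros q @ 1 # zeros (k - l) @ w"
  by (auto simp: delta_def replicate_add)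

lemma delta_append_zeros: "k - j + p = q \<Longrightarrow> delta k j @ zeros p @ w = zeros j @ 1 # zeros q @ w"
  by (auto simp: delta_def replicate_add)

lemma zeros_append_delta: "p + j = q \<Longrightarrow> zeros p @ delta k j @ w = zeros q @ 1 # zeros (k - j) @ w"
  by (auto simp: delta_def replicate_add)

text \<open>
  Upper bound of the dictionaries after \<open>t\<close> rounds and \<open>i\<close> pairs of the next one. The second and the fourth family
  come from consecutive factors of different pairs, which only LZMW records; they are included slightly
  before they arise.
\<close>

definition round_P :: "nat \<Rightarrow> nat \<Rightarrow> nat \<Rightarrow> nat list set" where
  "round_P m t i = base_P (2 * m) \<union>
     {delta (2 * m) (2 * m - t') @ delta (2 * m) (2 * m - i' - t') | t' i'. i' < m \<and> (t' < t \<or> t' = t \<and> i' < i)} \<union>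
     {delta (2 * m) (2 * m - i' - t') @ delta (2 * m) (2 * m - t') | t' i'. i' < m \<and> (t' < t \<or> t' = t \<and> i' < i)} \<union>
     {delta (2 * m) (2 * m - t') @ zeros (2 * m) | t'. t' < t} \<union>
     {zeros (2 * m) @ delta (2 * m) (2 * m - t' - 1) | t'. t' < t}"

text \<open>Recorded words are rewritten as sequences of runs of a. The first one or two run lengths
  reveal t' and i', so a match with the text becomes an equation between numbers; t < m keeps the
  natural subtractions exact.\<close>

lemma round_P_cases:
  assumes "x \<in> round_P m t i" "t < m"
  obtains "x \<in> base_P (2 * m)"
  | t' i' z where "x = zeros (2 * m - t') @ 1 # zeros (2 * m - i') @ 1 # z" "i' < m" "t' < t \<or> t' = t \<and> i' < i"
  | t' i' z where "x = zeros (2 * m - i' - t') @ 1 # zeros (2 * m + i') @ 1 # z" "i' < m" "t' < t \<or> t' = t \<and> i' < i"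
  | t' where "x = zeros (2 * m - t') @ 1 # zeros (2 * m + t')" "t' < t"
  | t' z where "x = zeros (4 * m - t' - 1) @ 1 # z" "t' < t"
proof -
  from assms(1) consider "x \<in> base_P (2 * m)"
  | t' i' where "x = delta (2 * m) (2 * m - t') @ delta (2 * m) (2 * m - i' - t')" "i' < m" "t' < t \<or> t' = t \<and> i' < i"
  | t' i' where "x = delta (2 * m) (2 * m - i' - t') @ delta (2 * m) (2 * m - t')" "i' < m" "t' < t \<or> t' = t \<and> i' < i"
  | t' where "x = delta (2 * m) (2 * m - t') @ zeros (2 * m)" "t' < t"
  | t' where "x = zeros (2 * m) @ delta (2 * m) (2 * m - t' - 1)" "t' < t"
    unfolding round_P_def by blast
  then show thesis
  proof cases
    case 1
    then show thesis by (rule that(1))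
  next
    case (2 t' i')
    then have "2 * m - (2 * m - t') + (2 * m - i' - t') = 2 * m - i'" using assms(2) by linarith
    then have "x = zeros (2 * m - t') @ 1 # zeros (2 * m - i') @ 1 # zeros (2 * m - (2 * m - i' - t'))"
      using 2 delta_append_delta[where w = "[]"] by simp
    then show thesis using that(2) 2 by blast
  next
    case (3 t' i')
    then have "2 * m - (2 * m - i' - t') + (2 * m - t') = 2 * m + i'" using assms(2) by linarith
    then have "x = zeros (2 * m - i' - t') @ 1 # zeros (2 * m + i') @ 1 # zeros (2 * m - (2 * m - t'))"
      using 3 delta_append_delta[where w = "[]"] by simp
    then show thesis using that(3) 3 by blast
  next
    case (4 t')
    then have "2 * m - (2 * m - t') + 2 * m = 2 * m + t'" using assms(2) by linarith
    then have "x = zeros (2 * m - t') @ 1 # zeros (2 * m + t')"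
      using 4 delta_append_zeros[where w = "[]"] by simp
    then show thesis using that(4) 4 by blast
  next
    case (5 t')
    then have "2 * m + (2 * m - t' - 1) = 4 * m - t' - 1" using assms(2) by linarith
    then have "x = zeros (4 * m - t' - 1) @ 1 # zeros (2 * m - (2 * m - t' - 1))"
      using 5 zeros_append_delta[where w = "[]"] by simp
    then show thesis using that(5) 5 by blast
  qed
qed

lemma base_P_short:
  assumes "x \<in> base_P k" "prefix x w" "set w \<inter> {2, 3, 5} = {}" "k > 0"
  shows "length x \<le> k + 1"
  using assms set_mono_prefix[OF assms(2)] by (auto simp: base_P_def)

lemma length_delta: "j \<le> k \<Longrightarrow> length (delta k j) = k + 1"
  by (simp add: delta_def)

text \<open>With k = 2m the text starts with the runs k - t and k - i. Matching the first family of
  pairs in \<open>round_P\<close> forces t' = t and i' = i, the second forces i' = i = 0 and t' = t,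
  the third t' = t; all contradict the order of recording. The fourth begins with a run longer than
  k. Base words have length at most k + 1.\<close>

lemma round_short_fst:
  assumes "t < m" "i < m" "set r \<inter> {2, 3, 5} = {}"
  shows "short_prefixes (round_P m t i)
    (delta (2 * m) (2 * m - t) @ delta (2 * m) (2 * m - i - t) @ r) (delta (2 * m) (2 * m - t))"
  unfolding short_prefixes_def
proof (intro ballI impI)
  fix x
  let ?w = "delta (2 * m) (2 * m - t) @ delta (2 * m) (2 * m - i - t) @ r"
  assume x: "x \<in> round_P m t i" "prefix x ?w"
  have s: "set ?w \<inter> {2, 3, 5} = {}" using assms(3) by (auto simp: delta_def)
  have "2 * m - (2 * m - t) + (2 * m - i - t) = 2 * m - i" using assms by linarith
  then have w: "?w = zeros (2 * m - t) @ 1 # zeros (2 * m - i) @ 1 # zeros (2 * m - (2 * m - i - t)) @ r"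
    by (rule delta_append_delta)
  from x(1) assms(1) have "x \<in> base_P (2 * m)"
  proof (cases rule: round_P_cases)
    case (2 t' i' z)
    with x(2) show ?thesis unfolding w using assms by auto
  next
    case (3 t' i' z)
    with x(2) show ?thesis unfolding w using assms by auto
  next
    case (4 t')
    with x(2) show ?thesis unfolding w using assms by auto
  next
    case (5 t' z)
    with x(2) show ?thesis unfolding w using assms by auto
  qed
  then show "length x \<le> length (delta (2 * m) (2 * m - t))"
    using base_P_short[OF _ x(2) s] assms by (simp add: length_delta)
qed

text \<open>Now the runs are k - i - t and k + i. The first family forces i' = i = 0 and t' = t, the
  second i' = i and t' = t, the third t' = t + i, contradicting t' < t; the fourth again begins with
  too long a run.\<close>

lemma round_short_snd:
  assumes "t < m" "i < m" "set r \<inter> {2, 3, 5} = {}"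
  shows "short_prefixes (round_P m t i)
    (delta (2 * m) (2 * m - i - t) @ delta (2 * m) (2 * m - t) @ r) (delta (2 * m) (2 * m - i - t))"
  unfolding short_prefixes_def
proof (intro ballI impI)
  fix x
  let ?w = "delta (2 * m) (2 * m - i - t) @ delta (2 * m) (2 * m - t) @ r"
  assume x: "x \<in> round_P m t i" "prefix x ?w"
  have s: "set ?w \<inter> {2, 3, 5} = {}" using assms(3) by (auto simp: delta_def)
  have "2 * m - (2 * m - i - t) + (2 * m - t) = 2 * m + i" using assms by linarith
  then have w: "?w = zeros (2 * m - i - t) @ 1 # zeros (2 * m + i) @ 1 # zeros (2 * m - (2 * m - t)) @ r"
    by (rule delta_append_delta)
  from x(1) assms(1) have "x \<in> base_P (2 * m)"
  proof (cases rule: round_P_cases)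
    case (2 t' i' z)
    with x(2) show ?thesis unfolding w using assms by auto
  next
    case (3 t' i' z)
    with x(2) show ?thesis unfolding w using assms by auto
  next
    case (4 t')
    with x(2) show ?thesis unfolding w using assms by auto
  next
    case (5 t' z)
    with x(2) show ?thesis unfolding w using assms by auto
  qed
  then show "length x \<le> length (delta (2 * m) (2 * m - i - t))"
    using base_P_short[OF _ x(2) s] assms by (simp add: length_delta)
qed

text \<open>The final a^k merges with the opening of the next round into a run of 4m - 1 letters,
  longer than every k - i' and k + i' with i' < m. In the last round the letter e ends the run
  instead of b. The third and fourth families fail already at the first run.\<close>

lemma round_end_short_fst:
  assumes "t < m" "set r \<inter> {2, 3, 5} = {}"
    and r: "r = [4, 6] \<or> (\<exists>r'. r = zeros (2 * m - t - 1) @ 1 # r')"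
  shows "short_prefixes (round_P m t m) (delta (2 * m) (2 * m - t) @ zeros (2 * m) @ r) (delta (2 * m) (2 * m - t))"
  unfolding short_prefixes_def
proof (intro ballI impI)
  fix x
  let ?w = "delta (2 * m) (2 * m - t) @ zeros (2 * m) @ r"
  assume x: "x \<in> round_P m t m" "prefix x ?w"
  have s: "set ?w \<inter> {2, 3, 5} = {}" using assms(2) by (auto simp: delta_def)
  have "\<exists>q z r'. ?w = zeros (2 * m - t) @ 1 # zeros q @ z # r' \<and> z \<noteq> 0 \<and> (z = 1 \<longrightarrow> q = 4 * m - 1)"
    using r
  proof
    assume "r = [4, 6]"
    moreover have "2 * m - (2 * m - t) + 2 * m = 2 * m + t" using assms(1) by simp
    ultimately have "?w = zeros (2 * m - t) @ 1 # zeros (2 * m + t) @ 4 # [6]"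
      using delta_append_zeros by blast
    then show ?thesis by (metis numeral_eq_one_iff semiring_norm(83) zero_neq_numeral)
  next
    assume "\<exists>r'. r = zeros (2 * m - t - 1) @ 1 # r'"
    then obtain r' where r': "r = zeros (2 * m - t - 1) @ 1 # r'" by blast
    have "2 * m - (2 * m - t) + (2 * m + (2 * m - t - 1)) = 4 * m - 1" using assms(1) by linarith
    then have "?w = zeros (2 * m - t) @ 1 # zeros (4 * m - 1) @ 1 # r'"
      unfolding r' by (subst zeros_append[OF refl]) (rule delta_append_zeros)
    then show ?thesis by (metis one_neq_zero)
  qed
  then obtain q z r' where w: "?w = zeros (2 * m - t) @ 1 # zeros q @ z # r'" and z: "z \<noteq> 0" "z = 1 \<Longrightarrow> q = 4 * m - 1"
    by blast
  have "x \<in> base_P (2 * m)" using x(1) assms(1)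
  proof (cases rule: round_P_cases)
    case (2 t' i' z)
    with x(2) show ?thesis unfolding w using assms(1) z by auto
  next
    case (3 t' i' z)
    with x(2) show ?thesis unfolding w using assms(1) z by auto
  next
    case (4 t')
    with x(2) show ?thesis unfolding w using assms(1) by auto
  next
    case (5 t' z)
    with x(2) show ?thesis unfolding w using assms(1) by auto
  qed
  then show "length x \<le> length (delta (2 * m) (2 * m - t))"
    using base_P_short[OF _ x(2) s] assms by (simp add: length_delta)
qed

text \<open>If a round follows, a^k begins a run of 4m - t - 1 letters. Only the fourth family has
  first runs of this size, namely 4m - t' - 1 with t' < t.\<close>

lemma round_end_short_snd:
  assumes "t < m" "set r \<inter> {2, 3, 5} = {}"
    and r: "r = [4, 6] \<or> (\<exists>r'. Suc t < m \<and> r = zeros (2 * m - t - 1) @ 1 # r')"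
  shows "short_prefixes (round_P m t m) (zeros (2 * m) @ r) (zeros (2 * m))"
  unfolding short_prefixes_def
proof (intro ballI impI)
  fix x
  let ?w = "zeros (2 * m) @ r"
  assume x: "x \<in> round_P m t m" "prefix x ?w"
  have s: "set ?w \<inter> {2, 3, 5} = {}" using assms(2) by auto
  have "\<exists>q z r'. ?w = zeros q @ z # r' \<and> z \<noteq> 0 \<and> (z = 1 \<longrightarrow> q = 4 * m - t - 1 \<and> Suc t < m)"
    using r
  proof
    assume "r = [4, 6]"
    then have "?w = zeros (2 * m) @ 4 # [6]" by simp
    then show ?thesis by (metis numeral_eq_one_iff semiring_norm(83) zero_neq_numeral)
  next
    assume "\<exists>r'. Suc t < m \<and> r = zeros (2 * m - t - 1) @ 1 # r'"
    then obtain r' where r': "Suc t < m" "r = zeros (2 * m - t - 1) @ 1 # r'" by blast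
    have "2 * m + (2 * m - t - 1) = 4 * m - t - 1" using assms(1) by linarith
    then have "?w = zeros (4 * m - t - 1) @ 1 # r'"
      unfolding r' by (rule zeros_append)
    then show ?thesis using r'(1) by (metis one_neq_zero)
  qed
  then obtain q z r' where w: "?w = zeros q @ z # r'" and z: "z \<noteq> 0" "z = 1 \<Longrightarrow> q = 4 * m - t - 1 \<and> Suc t < m"
    by blast
  have "x \<in> base_P (2 * m)" using x(1) assms(1)
  proof (cases rule: round_P_cases)
    case (2 t' i' z)
    with x(2) show ?thesis unfolding w using assms(1) z by auto
  next
    case (3 t' i' z)
    with x(2) show ?thesis unfolding w using assms(1) z by auto
  next
    case (4 t')
    with x(2) show ?thesis unfolding w using assms(1) z by auto
  next
    case (5 t' z)
    with x(2) show ?thesis unfolding w using assms(1) z by auto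
  qed
  \<comment> \<open>\<open>base_P_short\<close> would allow length k + 1, one more than a^k, so base
    words are inspected one by one: those with a letter b have at most k letters a before it,
    whereas the text has a longer run or the letter e.\<close>
  then consider "x = [4]" | j where "x = zeros j" "j \<le> 2 * m" | i l where "x = zeros i @ 1 # zeros l" "i + l \<le> 2 * m"
    using s set_mono_prefix[OF x(2)] unfolding base_P_def by blast
  then show "length x \<le> length (zeros (2 * m))"
  proof cases
    case (3 i l)
    with x(2) show ?thesis unfolding w using assms(1) z by auto
  qed (use assms(1) in auto)
qed

section \<open>Assembly of the rounds\<close>

definition round_pairs :: "nat \<Rightarrow> nat \<Rightarrow> (nat list \<times> nat list) list" where
  "round_pairs m t = concat (map (\<lambda>i. [(delta (2 * m) (2 * m - t), delta (2 * m) (2 * m - i - t))]) [0..<m]) @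
     [(delta (2 * m) (2 * m - t), zeros (2 * m))]"

definition final_dict :: "nat \<Rightarrow> nat list set" where
  "final_dict k = {[4], [6], zeros k} \<union> delta k ` {1..k}"

text \<open>The latest LZMW phrase before pair i of round t: the last separator, the a^k closing the
  previous round, or the second factor of the previous pair.\<close>

definition round_last :: "nat \<Rightarrow> nat \<Rightarrow> nat \<Rightarrow> nat list" where
  "round_last m t i = (if i = 0 then (if t = 0 then e_word 1 else zeros (2 * m))
     else delta (2 * m) (2 * m - (i - 1) - t))"

text \<open>This is where the early inclusions in \<open>round_P\<close> pay off: recording the word
  across two pairs leaves the bound unchanged.\<close>

lemma round_last_in:
  assumes "t < m" "i \<le> m"
  shows "round_last m t i @ delta (2 * m) (2 * m - t) \<in> round_P m t i"
proof (cases i)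
  case 0
  show ?thesis
  proof (cases t)
    case t: 0
    have "e_word 1 @ delta (2 * m) (2 * m - t) \<in> base_P (2 * m)" by (simp add: base_P_def e_word_def)
    then show ?thesis by (simp add: 0 t round_last_def round_P_def)
  next
    case (Suc t')
    then have "t' < t" "2 * m - t = 2 * m - t' - 1" by auto
    then have "zeros (2 * m) @ delta (2 * m) (2 * m - t) \<in> {zeros (2 * m) @ delta (2 * m) (2 * m - t' - 1) | t'. t' < t}"
      by auto
    then show ?thesis by (simp add: 0 Suc round_last_def round_P_def)
  qed
next
  case (Suc i')
  then have "delta (2 * m) (2 * m - i' - t) @ delta (2 * m) (2 * m - t) \<in>
     {delta (2 * m) (2 * m - i' - t') @ delta (2 * m) (2 * m - t') | t' i'. i' < m \<and> (t' < t \<or> t' = t \<and> i' < i)}"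
    using assms by fastforce
  then show ?thesis unfolding round_P_def round_last_def using Suc by simp
qed

lemma round_P_mono:
  assumes "\<And>t' i'. i' < m \<Longrightarrow> t' < t \<or> t' = t \<and> i' < i \<Longrightarrow> t' < s \<or> t' = s \<and> i' < j" "t \<le> s"
  shows "round_P m t i \<subseteq> round_P m s j"
proof -
  have "t' < s" if "t' < t" for t' using that assms(2) by simp
  then show ?thesis
    unfolding round_P_def using assms(1) by (intro Un_mono Collect_mono order_refl impI; blast)
qed

lemma round_step:
  assumes t: "t < m" and i: "i < m" and r: "set r \<inter> {2, 3, 5} = {}"
  shows "parses (final_dict (2 * m)) (round_P m t i) (round_last m t i)
    [(delta (2 * m) (2 * m - t), delta (2 * m) (2 * m - i - t))] (delta (2 * m) (2 * m - t) @ r)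
    (final_dict (2 * m)) (round_P m t (Suc i)) (round_last m t (Suc i))"
proof -
  have l: "insert (round_last m t i @ delta (2 * m) (2 * m - t)) (round_P m t i) = round_P m t i"
    using round_last_in[of t m i] t i by (simp add: insert_absorb)
  \<comment> \<open>Since i and t are at most m - 1, the index 2m - i - t is at least 2 and stays in
    the range 1..2m; this is why k = 2m.\<close>
  have d: "delta (2 * m) (2 * m - t) \<in> final_dict (2 * m)" "delta (2 * m) (2 * m - i - t) \<in> final_dict (2 * m)"
    using t i by (auto simp: final_dict_def)
  have p: "insert (delta (2 * m) (2 * m - t) @ delta (2 * m) (2 * m - i - t)) (round_P m t i) \<subseteq> round_P m t (Suc i)"
  proof -
    have "delta (2 * m) (2 * m - t) @ delta (2 * m) (2 * m - i - t) \<in> round_P m t (Suc i)"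
      unfolding round_P_def using i by blast
    moreover have "round_P m t i \<subseteq> round_P m t (Suc i)"
      by (rule round_P_mono) auto
    ultimately show ?thesis by simp
  qed
  have s: "set (delta (2 * m) (2 * m - t) @ r) \<inter> {2, 3, 5} = {}" using r by (auto simp: delta_def)
  show ?thesis
    unfolding parses.simps l
    using d p round_short_fst[OF t i s] round_short_snd[OF t i r] by (auto simp: round_last_def)
qed

lemma round_end:
  assumes t: "t < m" and r: "set r \<inter> {2, 3, 5} = {}"
    and r': "r = [4, 6] \<or> (\<exists>r'. Suc t < m \<and> r = zeros (2 * m - t - 1) @ 1 # r')"
  shows "parses (final_dict (2 * m)) (round_P m t m) (round_last m t m)
    [(delta (2 * m) (2 * m - t), zeros (2 * m))] r
    (final_dict (2 * m)) (round_P m (Suc t) 0) (round_last m (Suc t) 0)"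
proof -
  have l: "insert (round_last m t m @ delta (2 * m) (2 * m - t)) (round_P m t m) = round_P m t m"
    using round_last_in[of t m m] t by (simp add: insert_absorb)
  have d: "delta (2 * m) (2 * m - t) \<in> final_dict (2 * m)" "zeros (2 * m) \<in> final_dict (2 * m)"
    using t by (auto simp: final_dict_def)
  have p: "insert (delta (2 * m) (2 * m - t) @ zeros (2 * m)) (round_P m t m) \<subseteq> round_P m (Suc t) 0"
  proof -
    have "delta (2 * m) (2 * m - t) @ zeros (2 * m) \<in> round_P m (Suc t) 0"
      unfolding round_P_def by blast
    moreover have "round_P m t m \<subseteq> round_P m (Suc t) 0"
      by (rule round_P_mono) auto
    ultimately show ?thesis by simp
  qed
  have r'': "r = [4, 6] \<or> (\<exists>r'. r = zeros (2 * m - t - 1) @ 1 # r')" using r' by blast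
  show ?thesis
    unfolding parses.simps l
    using d p round_end_short_fst[OF t r r''] round_end_short_snd[OF t r r'] by (auto simp: round_last_def)
qed

lemma round_pairs_parses:
  assumes t: "t < m" and r: "set r \<inter> {2, 3, 5} = {}"
    and r': "r = [4, 6] \<or> (\<exists>r'. Suc t < m \<and> r = zeros (2 * m - t - 1) @ 1 # r')"
  shows "parses (final_dict (2 * m)) (round_P m t 0) (round_last m t 0) (round_pairs m t) r
    (final_dict (2 * m)) (round_P m (Suc t) 0) (round_last m (Suc t) 0)"
  unfolding round_pairs_def
proof (rule parses_append[OF _ round_end[OF assms]])
  let ?U = "\<lambda>i. [(delta (2 * m) (2 * m - t), delta (2 * m) (2 * m - i - t))]"
  let ?r = "concat (phrases [(delta (2 * m) (2 * m - t), zeros (2 * m))]) @ r"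
  let ?R = "remaining ?U m ?r"
  have "parses (final_dict (2 * m)) (round_P m t 0) (round_last m t 0) (concat (map ?U [0..<m])) (?R m)
    (final_dict (2 * m)) (round_P m t m) (round_last m t m)"
  proof (rule parses_loop[where R = ?R and L = "\<lambda>_. final_dict (2 * m)"])
    fix i assume i: "i < m"
    have "\<exists>r'. ?R (Suc i) = delta (2 * m) (2 * m - t) @ r'"
    proof (cases "Suc i < m")
      case True
      then show ?thesis by (simp add: remaining_step)
    next
      case False
      then have "Suc i = m" using i by simp
      then show ?thesis by simp
    qed
    then obtain r' where r': "?R (Suc i) = delta (2 * m) (2 * m - t) @ r'" by blast
    have "set (?R (Suc i)) \<subseteq> {0, 1} \<union> set r"
      by (auto simp: remaining_def delta_def phrases_def)
    then have "set r' \<subseteq> {0, 1} \<union> set r" unfolding r' by simp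
    then have "set r' \<inter> {2, 3, 5} = {}" using r by auto
    then show "parses (final_dict (2 * m)) (round_P m t i) (round_last m t i) (?U i) (?R (Suc i))
       (final_dict (2 * m)) (round_P m t (Suc i)) (round_last m t (Suc i))"
      unfolding r' by (rule round_step[OF t i])
  qed (simp add: remaining_step)
  then show "parses (final_dict (2 * m)) (round_P m t 0) (round_last m t 0) (concat (map ?U [0..<m])) ?r
    (final_dict (2 * m)) (round_P m t m) (round_last m t m)" by simp
qed

lemma hd_round_pairs: "0 < m \<Longrightarrow> \<exists>r. concat (phrases (round_pairs m t)) = zeros (2 * m - t) @ 1 # r"
  by (simp add: round_pairs_def upt_conv_Cons delta_def del: upt_Suc)

lemma rounds_parses:
  assumes m: "0 < m"
  shows "parses (final_dict (2 * m)) (base_P (2 * m)) (e_word 1) (concat (map (round_pairs m) [0..<m])) [4, 6]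
    (final_dict (2 * m)) (round_P m m 0) (zeros (2 * m))"
proof -
  let ?R = "remaining (round_pairs m) m [4, 6]"
  have "parses (final_dict (2 * m)) (round_P m 0 0) (round_last m 0 0) (concat (map (round_pairs m) [0..<m])) (?R m)
    (final_dict (2 * m)) (round_P m m 0) (round_last m m 0)"
  proof (rule parses_loop[where R = ?R and L = "\<lambda>_. final_dict (2 * m)" and P = "\<lambda>t. round_P m t 0" and l = "\<lambda>t. round_last m t 0"])
    fix t assume t: "t < m"
    have "set (?R (Suc t)) \<subseteq> {0, 1} \<union> {4, 6}"
      by (auto simp: remaining_def round_pairs_def phrases_def delta_def)
    then have "set (?R (Suc t)) \<inter> {2, 3, 5} = {}" by auto
    moreover have "?R (Suc t) = [4, 6] \<or> (\<exists>r'. Suc t < m \<and> ?R (Suc t) = zeros (2 * m - t - 1) @ 1 # r')"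
    proof (cases "Suc t < m")
      case True
      then show ?thesis using hd_round_pairs[OF m, of "Suc t"] by (auto simp: remaining_step)
    next
      case False
      then have "Suc t = m" using t by simp
      then show ?thesis by simp
    qed
    ultimately show "parses (final_dict (2 * m)) (round_P m t 0) (round_last m t 0) (round_pairs m t) (?R (Suc t))
      (final_dict (2 * m)) (round_P m (Suc t) 0) (round_last m (Suc t) 0)"
      by (rule round_pairs_parses[OF t])
  qed (simp add: remaining_step)
  moreover have "round_P m 0 0 = base_P (2 * m)" by (simp add: round_P_def)
  ultimately show ?thesis using m by (simp add: round_last_def)
qed

text \<open>The letter e in front of the end marker gives the last LZD phrase two factors, which
  keeps both parsings aligned. Nothing follows, so the final bounds are trivial.\<close>

lemma tail_parses:
  "parses (final_dict (2 * m)) (round_P m m 0) (zeros (2 * m)) [([4], [6])] [] {} UNIV [6]"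
proof -
  have "length x \<le> 1" if x: "x \<in> insert [4] (round_P m m 0)" "prefix x [4, 6]" for x
  proof -
    have "set x \<subseteq> {4, 6}" using set_mono_prefix[OF x(2)] by simp
    moreover have "1 \<notin> set x"
      using calculation by auto
    ultimately show ?thesis
      using x(1) by (auto simp: round_P_def base_P_def delta_def split: if_splits)
  qed
  moreover have "length x \<le> 1" if "prefix x [6]" for x :: "nat list"
    using prefix_length_le[OF that] by simp
  ultimately show ?thesis
    by (simp add: final_dict_def short_prefixes_def)
qed

abbreviation (input) text_of :: "('a list \<times> 'a list) list \<Rightarrow> 'a list" where
  "text_of fs \<equiv> concat (phrases fs)"

section \<open>The string and its smallest grammar\<close>

definition chain_pairs :: "nat \<Rightarrow> (nat list \<times> nat list) list" where
  "chain_pairs i = concat (map chain [0..<i])"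

definition ins_pairs :: "nat \<Rightarrow> nat \<Rightarrow> (nat list \<times> nat list) list" where
  "ins_pairs k i = concat (map (insertion (ins_fst k) (ins_snd k) (3 * k - 2)) [0..<i])"

definition rounds_pairs :: "nat \<Rightarrow> nat \<Rightarrow> (nat list \<times> nat list) list" where
  "rounds_pairs m i = concat (map (round_pairs m) [0..<i])"

definition lz_pairs :: "nat \<Rightarrow> (nat list \<times> nat list) list" where
  "lz_pairs m = (chain_pairs (6 * m - 2) @ ins_pairs (2 * m) (6 * m - 2)) @ rounds_pairs m m @ [([4], [6])]"

definition lz_text :: "nat \<Rightarrow> nat list" where
  "lz_text m = text_of (lz_pairs m)"

lemma lz_pairs_parses:
  assumes m: "0 < m"
  shows "parses {[a] | a. a \<in> {..6}} {} [] (lz_pairs m) [] {} UNIV [6]"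
proof -
  have M: "6 * m - 2 = 3 * (2 * m) - 2" by simp
  obtain w where w: "text_of (rounds_pairs m m @ [([4], [6])]) @ [] = 0 # w"
  proof -
    obtain n where n: "m = Suc n" using m by (cases m) auto
    have "[0..<m] = 0 # [1..<m]" using n by (simp add: upt_conv_Cons del: upt_Suc)
    then show thesis
      using that hd_round_pairs[OF m, of 0] by (auto simp: rounds_pairs_def n)
  qed
  have "parses {[a] | a. a \<in> {..6}} {} [] (chain_pairs (6 * m - 2) @ ins_pairs (2 * m) (6 * m - 2))
     (text_of (rounds_pairs m m @ [([4], [6])]) @ []) (final_dict (2 * m)) (base_P (2 * m)) (e_word 1)"
    using chain_ins_parses[of "2 * m", OF _ w] m unfolding M
    by (simp add: final_dict_def chain_pairs_def ins_pairs_def)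
  moreover have "parses (final_dict (2 * m)) (base_P (2 * m)) (e_word 1) (rounds_pairs m m @ [([4], [6])]) [] {} UNIV [6]"
    using rounds_parses[OF m] by (intro parses_append[OF _ tail_parses[of m]]) (simp add: rounds_pairs_def)
  ultimately show ?thesis unfolding lz_pairs_def by (rule parses_append)
qed

section \<open>Number of phrases and length of the text\<close>

lemma length_lz_pairs: "m * m \<le> length (lz_pairs m)"
proof -
  have "length (round_pairs m t) = Suc m" for t
    by (simp add: round_pairs_def length_concat comp_def sum_list_triv)
  then have "length (rounds_pairs m i) = i * Suc m" for i
    by (induction i) (simp_all add: rounds_pairs_def)
  then show ?thesis by (simp add: lz_pairs_def)
qed

lemma length_text_rounds:
  assumes "i \<le> m"
  shows "length (text_of (rounds_pairs m i)) \<le> i * ((m + 1) * (4 * m + 2))"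
    and "i \<le> length (text_of (rounds_pairs m i))"
proof -
  have *: "length (text_of (round_pairs m t)) = m * (4 * m + 2) + 4 * m + 1" if "t < m" for t
  proof -
    have "length (text_of (concat (map (\<lambda>i. [(delta (2 * m) (2 * m - t), delta (2 * m) (2 * m - i - t))]) [0..<j]))) = j * (4 * m + 2)"
      for j by (induction j) (simp_all add: length_delta)
    then show ?thesis unfolding round_pairs_def by (simp add: length_delta)
  qed
  show "length (text_of (rounds_pairs m i)) \<le> i * ((m + 1) * (4 * m + 2))"
    using assms
  proof (induction i)
    case (Suc i)
    then show ?case using *[of i] by (simp add: rounds_pairs_def algebra_simps)
  qed (simp add: rounds_pairs_def)
  show "i \<le> length (text_of (rounds_pairs m i))"
    using assms
  proof (induction i)
    case (Suc i)
    then show ?case using *[of i] by (simp add: rounds_pairs_def)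
  qed (simp add: rounds_pairs_def)
qed

lemma length_text_chain: "length (text_of (chain_pairs i)) \<le> i * (2 * i + 2)"
proof (induction i)
  case (Suc i)
  then show ?case by (simp add: chain_pairs_def chain_def algebra_simps)
qed (simp add: chain_pairs_def)

lemma length_text_ins:
  "i \<le> 3 * k - 2 \<Longrightarrow> length (text_of (ins_pairs k i)) \<le> i * (7 * k)"
proof (induction i)
  case (Suc i)
  then have i: "i < 3 * k - 2" by simp
  \<comment> \<open>The two separators add at most 3k - 1 letters each, which gives 7k in
    total.\<close>
  have "length (ins_fst k i) + length (ins_snd k i) \<le> k + 1"
    by (rule ins_cases[OF i]) auto
  then show ?case using Suc by (simp add: ins_pairs_def insertion_def algebra_simps)
qed (simp add: ins_pairs_def)

text \<open>The lower bound makes n unbounded. The constant 216 is 6^3, so that the cube root of the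
  upper bound is 6m.\<close>

lemma length_lz_text:
  assumes "0 < m"
  shows "m \<le> length (lz_text m)" "length (lz_text m) \<le> 216 * m ^ 3"
proof -
  have 0: "m \<le> m ^ 3" "m ^ 2 \<le> m ^ 3" "1 \<le> m ^ 3" using assms by (auto simp: self_le_power power_increasing)
  have 1: "length (text_of (chain_pairs (6 * m - 2))) \<le> 72 * m ^ 2 + 12 * m"
    by (rule order_trans[OF length_text_chain], rule order_trans[OF mult_mono[of _ "6 * m" _ "2 * (6 * m) + 2"]])
      (auto simp: power2_eq_square algebra_simps)
  have "length (text_of (ins_pairs (2 * m) (6 * m - 2))) \<le> (6 * m - 2) * (7 * (2 * m))"
    by (rule length_text_ins) simp
  also have "\<dots> \<le> 84 * m ^ 2" by (auto simp: power2_eq_square algebra_simps)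
  finally have 2: "length (text_of (ins_pairs (2 * m) (6 * m - 2))) \<le> 84 * m ^ 2" .
  have 3: "length (text_of (rounds_pairs m m)) \<le> 4 * m ^ 3 + 6 * m ^ 2 + 2 * m"
    using length_text_rounds(1)[of m m] by (simp add: power2_eq_square power3_eq_cube algebra_simps)
  show "length (lz_text m) \<le> 216 * m ^ 3"
    using 0 1 2 3 unfolding lz_text_def lz_pairs_def by simp
  show "m \<le> length (lz_text m)"
    using length_text_rounds(2)[of m m] unfolding lz_text_def lz_pairs_def by simp
qed

lemma lz_text_dollar: "dollar_terminated 6 (lz_text m)" and set_lz_text: "set (lz_text m) \<subseteq> {..6}"
proof -
  have 1: "set (text_of (chain_pairs i)) \<subseteq> {..5}" for i
    by (induction i) (auto simp: chain_pairs_def chain_def e_word_def f_word_def)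
  have 2: "set (text_of (ins_pairs k i)) \<subseteq> {..5}" for k i
    by (induction i) (auto simp: ins_pairs_def insertion_def e_word_def ins_fst_def ins_snd_def split: if_splits)
  have 3: "set (text_of (rounds_pairs m i)) \<subseteq> {..5}" for i
    by (auto simp: rounds_pairs_def round_pairs_def phrases_def delta_def)
  let ?t = "text_of (chain_pairs (6 * m - 2)) @ text_of (ins_pairs (2 * m) (6 * m - 2)) @ text_of (rounds_pairs m m) @ [4]"
  have t: "lz_text m = ?t @ [6]" by (simp add: lz_text_def lz_pairs_def)
  have s: "set ?t \<subseteq> {..5}" using 1 2 3 by simp
  then have "6 \<notin> set ?t" by auto
  with t show "dollar_terminated 6 (lz_text m)" unfolding dollar_terminated_def by blast
  show "set (lz_text m) \<subseteq> {..6}" unfolding t using s by auto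
qed

section \<open>Periodicity of the rounds and a small grammar\<close>

definition hills :: "nat \<Rightarrow> nat \<Rightarrow> nat list" where
  "hills k i = concat (map (\<lambda>i. zeros (k - i) @ 1 # zeros (k + i) @ [1]) [0..<i])"

definition period :: "nat \<Rightarrow> nat list" where
  "period m = zeros (2 * m) @ 1 # hills (2 * m) m @ zeros (2 * m - 1)"

text \<open>The shift by t cancels in every run between two letters b: t + (k - i - t) = k - i and
  (i + t) + (k - t) = k + i with k = 2m. Only the two outer runs depend on t.\<close>

lemma text_round_pairs:
  assumes "t < m"
  shows "text_of (round_pairs m t) = zeros (2 * m - t) @ 1 # hills (2 * m) m @ zeros (2 * m + t)"
proof -
  \<comment> \<open>The appended a^(2m-t) b is the beginning of the next first factor; with it the
    partial text ends in b and fits \<open>hills\<close>.\<close>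
  have "text_of (concat (map (\<lambda>i. [(delta (2 * m) (2 * m - t), delta (2 * m) (2 * m - i - t))]) [0..<j]))
      @ zeros (2 * m - t) @ [1] = zeros (2 * m - t) @ 1 # hills (2 * m) j" if "j \<le> m" for j
    using that
  proof (induction j)
    case (Suc j)
    have e: "2 * m - (2 * m - t) + (2 * m - j - t) = 2 * m - j"
      "2 * m - (2 * m - j - t) + (2 * m - t) = 2 * m + j" using Suc.prems assms by linarith+
    have "text_of (concat (map (\<lambda>i. [(delta (2 * m) (2 * m - t), delta (2 * m) (2 * m - i - t))]) [0..<Suc j]))
        @ zeros (2 * m - t) @ [1] =
      text_of (concat (map (\<lambda>i. [(delta (2 * m) (2 * m - t), delta (2 * m) (2 * m - i - t))]) [0..<j]))
        @ delta (2 * m) (2 * m - t) @ delta (2 * m) (2 * m - j - t) @ zeros (2 * m - t) @ [1]" by simp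
    also have "\<dots> = text_of (concat (map (\<lambda>i. [(delta (2 * m) (2 * m - t), delta (2 * m) (2 * m - i - t))]) [0..<j]))
        @ zeros (2 * m - t) @ 1 # zeros (2 * m - j) @ 1 # zeros (2 * m + j) @ [1]"
      unfolding delta_append_delta[OF e(1)] zeros_append[OF e(2)] ..
    also have "\<dots> = zeros (2 * m - t) @ 1 # hills (2 * m) (Suc j)"
      using Suc by (simp add: hills_def)
    finally show ?case .
  qed (simp add: hills_def)
  from this[of m] have *: "text_of (concat (map (\<lambda>i. [(delta (2 * m) (2 * m - t), delta (2 * m) (2 * m - i - t))]) [0..<m]))
      @ zeros (2 * m - t) @ [1] = zeros (2 * m - t) @ 1 # hills (2 * m) m" by simp
  have "2 * m - (2 * m - t) + 2 * m = 2 * m + t" using assms by simp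
  then have "delta (2 * m) (2 * m - t) @ zeros (2 * m) @ [] = (zeros (2 * m - t) @ [1]) @ zeros (2 * m + t)"
    by (subst delta_append_zeros) simp_all
  then have "text_of (round_pairs m t) = (text_of (concat (map (\<lambda>i. [(delta (2 * m) (2 * m - t), delta (2 * m) (2 * m - i - t))]) [0..<m]))
      @ zeros (2 * m - t) @ [1]) @ zeros (2 * m + t)"
    by (simp add: round_pairs_def)
  then show ?thesis unfolding * by simp
qed

text \<open>
  Each round ends \<open>t + 1\<close> letters into the next period, and the next round begins there.
\<close>

lemma text_rounds_pairs:
  "t \<le> m \<Longrightarrow> text_of (rounds_pairs m t) = concat (replicate t (period m)) @ zeros t"
proof (induction t)
  case (Suc t)
  have e: "t + (2 * m - t) = 2 * m" "2 * m - 1 + Suc t = 2 * m + t" using Suc.prems by linarith+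
  have "text_of (rounds_pairs m (Suc t)) = text_of (rounds_pairs m t) @ text_of (round_pairs m t)"
    by (simp add: rounds_pairs_def)
  also have "\<dots> = concat (replicate t (period m)) @ zeros t @ zeros (2 * m - t) @ 1 # hills (2 * m) m @ zeros (2 * m + t) @ []"
    using Suc text_round_pairs[of t m] by simp
  also have "\<dots> = concat (replicate t (period m)) @ period m @ zeros (Suc t)"
    unfolding period_def zeros_append[OF e(1)] zeros_append[OF e(2), symmetric] by simp
  also have "\<dots> = concat (replicate (Suc t) (period m)) @ zeros (Suc t)"
    by (simp flip: replicate_append_same)
  finally show ?case .
qed (simp add: rounds_pairs_def)

text \<open>Powers of a, separators, chain words, prefixes of the two preamble parts, prefixes of
  \<open>hills\<close> and powers of the period are built in turn. Each family has O(m) members with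
  right-hand sides of bounded length.\<close>

lemma slp_lz_text:
  assumes m: "0 < m"
  shows "\<exists>V n. slp V n \<and> lz_text m \<in> V \<and> n \<le> 110 * m"
proof -
  define M where "M = 6 * m - 2"
  define chars where "chars = {[a] | a :: nat. True}"
  define Z where "Z = (\<lambda>i. replicate (Suc i) (0 :: nat)) ` {..<4 * m}"
  define C where "C i = text_of (chain_pairs i)" for i
  define I where "I i = text_of (ins_pairs (2 * m) i)" for i
  define X where "X i = concat (replicate i (period m))" for i
  have z: "zeros p \<in> insert [] Z" if "p \<le> 4 * m" for p
    using that unfolding Z_def by (cases p) auto
  \<comment> \<open>The empty word is available at no cost, so that \<open>zeros p\<close> may be
    used for p = 0 as well.\<close>
  have "slp (insert (concat []) {}) (0 + 0)" by (rule slp.rule[OF slp.empty]) auto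
  then have "slp {[] :: nat list} 0" by simp
  from slp_powers[OF this, of 0 "4 * m"] have "slp ({[]} \<union> Z) (0 + 4 * m * 2)" unfolding Z_def .
  then have 1: "slp (insert [] Z) (8 * m)" by simp
  have 2: "slp (insert [] Z \<union> e_word ` {..<Suc M}) (8 * m + Suc M * 2)"
    by (rule slp_family[OF 1, where \<alpha> = "\<lambda>j. case j of 0 \<Rightarrow> [[2]] | Suc j \<Rightarrow> [[4], e_word j]"])
      (auto simp: e_word_def split: nat.splits)
  have 3: "slp (insert [] Z \<union> e_word ` {..<Suc M} \<union> f_word ` {..<Suc M}) (8 * m + Suc M * 2 + Suc M * 2)"
    by (rule slp_family[OF 2, where \<alpha> = "\<lambda>j. case j of 0 \<Rightarrow> [[5]] | Suc j \<Rightarrow> [[3], f_word j]"])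
      (auto simp: f_word_def split: nat.splits)
  define V3 where "V3 = insert [] Z \<union> e_word ` {..<Suc M} \<union> f_word ` {..<Suc M}"
  have V3: "zeros p \<in> V3" if "p \<le> 4 * m" for p using z[OF that] by (auto simp: V3_def)
  have V3': "e_word j \<in> V3" "f_word j \<in> V3" if "j \<le> M" for j using that by (auto simp: V3_def)
  have C_Suc: "C (Suc i) = C i @ e_word (Suc i) @ f_word (Suc i)" "C 0 = []" for i
    by (simp_all add: C_def chain_pairs_def chain_def e_word_Suc f_word_Suc)
  have 4: "slp (V3 \<union> C ` {..<Suc M}) (8 * m + Suc M * 2 + Suc M * 2 + Suc M * 3)"
    by (rule slp_family[OF 3[folded V3_def], where \<alpha> = "\<lambda>j. case j of 0 \<Rightarrow> [] | Suc j \<Rightarrow> [C j, e_word (Suc j), f_word (Suc j)]"])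
      (use V3' in \<open>auto simp: C_Suc split: nat.splits\<close>)
  have I_Suc: "I (Suc i) = I i @ (ins_fst (2 * m) i @ ins_snd (2 * m) i) @ e_word (M - i) @ e_word (M - i)" "I 0 = []" for i
    by (simp_all add: I_def ins_pairs_def insertion_def M_def)
  \<comment> \<open>At most three symbols suffice per inserted word; the preceding prefix and two
    separators make six.\<close>
  have "\<exists>\<beta>. ins_fst (2 * m) i @ ins_snd (2 * m) i = concat \<beta> \<and> length \<beta> \<le> 3 \<and> set \<beta> \<subseteq> V3 \<union> chars" if "i < M" for i
  proof -
    have i: "i < 3 * (2 * m) - 2" using that by (simp add: M_def)
    from ins_cases[OF i] show ?thesis
    proof cases
      case (1 p)
      then show ?thesis using V3[of p] by (intro exI[of _ "[zeros p, [0]]"]) (auto simp: chars_def)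
    next
      case (2 p)
      then show ?thesis using V3[of p] by (intro exI[of _ "[zeros p, [1]]"]) (auto simp: chars_def)
    next
      case (3 p)
      then show ?thesis using V3[of p] V3[of "2 * m - p"]
        by (intro exI[of _ "[zeros p, [1], zeros (2 * m - p)]"]) (auto simp: chars_def)
    qed
  qed
  then obtain \<beta> where \<beta>: "\<And>i. i < M \<Longrightarrow> ins_fst (2 * m) i @ ins_snd (2 * m) i = concat (\<beta> i)"
    "\<And>i. i < M \<Longrightarrow> length (\<beta> i) \<le> 3" "\<And>i. i < M \<Longrightarrow> set (\<beta> i) \<subseteq> V3 \<union> chars" by metis
  define V4 where "V4 = V3 \<union> C ` {..<Suc M}"
  have 5: "slp (V4 \<union> I ` {..<Suc M}) (8 * m + Suc M * 2 + Suc M * 2 + Suc M * 3 + Suc M * 6)"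
  proof (rule slp_family[OF 4[folded V4_def], where \<alpha> = "\<lambda>j. case j of 0 \<Rightarrow> [] | Suc j \<Rightarrow> I j # \<beta> j @ [e_word (M - j), e_word (M - j)]"])
    fix i assume i: "i < Suc M"
    show "I i = concat (case i of 0 \<Rightarrow> [] | Suc j \<Rightarrow> I j # \<beta> j @ [e_word (M - j), e_word (M - j)])"
      using i \<beta>(1) by (auto simp: I_Suc split: nat.splits)
    show "length (case i of 0 \<Rightarrow> [] | Suc j \<Rightarrow> I j # \<beta> j @ [e_word (M - j), e_word (M - j)]) \<le> 6"
      using i \<beta>(2) by (fastforce split: nat.splits)
    show "set (case i of 0 \<Rightarrow> [] | Suc j \<Rightarrow> I j # \<beta> j @ [e_word (M - j), e_word (M - j)]) \<subseteq> V4 \<union> {[a] | a. True} \<union> I ` {..<i}"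
    proof (cases i)
      case (Suc j)
      then have "set (\<beta> j) \<subseteq> V3 \<union> chars" "e_word (M - j) \<in> V3" using i \<beta>(3) V3' by auto
      then show ?thesis using Suc by (auto simp: V4_def chars_def)
    qed simp
  qed
  define V5 where "V5 = V4 \<union> I ` {..<Suc M}"
  have V5: "zeros p \<in> V5" if "p \<le> 4 * m" for p using V3[OF that] by (simp add: V5_def V4_def)
  have H_Suc: "hills (2 * m) (Suc i) = hills (2 * m) i @ zeros (2 * m - i) @ [1] @ zeros (2 * m + i) @ [1]" "hills (2 * m) 0 = []" for i
    by (simp_all add: hills_def)
  have 6: "slp (V5 \<union> hills (2 * m) ` {..<Suc m}) (8 * m + Suc M * 2 + Suc M * 2 + Suc M * 3 + Suc M * 6 + Suc m * 5)"
    by (rule slp_family[OF 5[folded V5_def], where \<alpha> = "\<lambda>j. case j of 0 \<Rightarrow> [] |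
        Suc j \<Rightarrow> [hills (2 * m) j, zeros (2 * m - j), [1], zeros (2 * m + j), [1]]"])
      (use V5 in \<open>auto simp: H_Suc split: nat.splits\<close>)
  define V6 where "V6 = V5 \<union> hills (2 * m) ` {..<Suc m}"
  have "slp (insert (concat [zeros (2 * m), [1], hills (2 * m) m, zeros (2 * m - 1)]) V6)
      (8 * m + Suc M * 2 + Suc M * 2 + Suc M * 3 + Suc M * 6 + Suc m * 5 + 4)"
    by (rule slp.rule[OF 6[folded V6_def]]) (use V5 in \<open>auto simp: V6_def\<close>)
  then have 7: "slp (insert (period m) V6) (8 * m + Suc M * 2 + Suc M * 2 + Suc M * 3 + Suc M * 6 + Suc m * 5 + 4)"
    by (simp add: period_def)
  have X_Suc: "X (Suc i) = X i @ period m" "X 0 = []" for i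
    by (simp_all add: X_def flip: replicate_append_same)
  have 8: "slp (insert (period m) V6 \<union> X ` {..<Suc m})
      (8 * m + Suc M * 2 + Suc M * 2 + Suc M * 3 + Suc M * 6 + Suc m * 5 + 4 + Suc m * 2)"
    by (rule slp_family[OF 7, where \<alpha> = "\<lambda>j. case j of 0 \<Rightarrow> [] | Suc j \<Rightarrow> [X j, period m]"])
      (auto simp: X_Suc split: nat.splits)
  define V8 where "V8 = insert (period m) V6 \<union> X ` {..<Suc m}"
  have mem: "C M \<in> V8" "I M \<in> V8" "X m \<in> V8" "zeros m \<in> V8"
    using V5[of m] by (auto simp: V8_def V6_def V5_def V4_def)
  have "slp (insert (concat [C M, I M, X m, zeros m, [4], [6]]) V8)
      (8 * m + Suc M * 2 + Suc M * 2 + Suc M * 3 + Suc M * 6 + Suc m * 5 + 4 + Suc m * 2 + 6)"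
    by (rule slp.rule[OF 8[folded V8_def]]) (use mem in auto)
  moreover have "lz_text m = concat [C M, I M, X m, zeros m, [4], [6]]"
    using text_rounds_pairs[of m m] by (simp add: lz_text_def lz_pairs_def C_def I_def X_def M_def)
  \<comment> \<open>With M + 1 = 6m - 1 the sum equals 93m + 4.\<close>
  moreover have "8 * m + Suc M * 2 + Suc M * 2 + Suc M * 3 + Suc M * 6 + Suc m * 5 + 4 + Suc m * 2 + 6 \<le> 110 * m"
    using m by (simp add: M_def)
  ultimately show ?thesis by (metis insertI1)
qed

lemma smallest_grammar_size_lz_text: "0 < m \<Longrightarrow> smallest_grammar_size (lz_text m) \<le> 110 * m"
  using slp_lz_text smallest_grammar_size_slp by (meson order_trans)

section \<open>Combination of the bounds\<close>

lemma cube_powr_third: "0 < b \<Longrightarrow> (b ^ 3) powr (1 / 3) = (b :: real)"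
  by (simp add: powr_powr flip: powr_numeral)

theorem theorem1:
  "\<exists>(\<Sigma> :: nat set) (d :: nat) (c :: real).
     finite \<Sigma> \<and> d \<in> \<Sigma> \<and> c > 0 \<and>
     (\<forall>N :: nat. \<exists>n \<ge> N.
        (\<exists>s. length s = n \<and> set s \<subseteq> \<Sigma> \<and> dollar_terminated d s \<and>
           real (grammar_size (lzd_grammar \<Sigma> s))
             \<ge> c * real n powr (1/3) * real (smallest_grammar_size s)) \<and>
        (\<exists>s. length s = n \<and> set s \<subseteq> \<Sigma> \<and> dollar_terminated d s \<and>
           real (grammar_size (lzmw_grammar \<Sigma> s))
             \<ge> c * real n powr (1/3) * real (smallest_grammar_size s)))"
\<comment> \<open>The constant comes from m^2 phrases against (6m)(110m) = 660 m^2.\<close>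
proof (rule exI[of _ "{..6}"], rule exI[of _ 6], rule exI[of _ "1 / 660"], intro conjI allI)
  fix N
  define m where "m = Suc N"
  let ?s = "lz_text m"
  have m: "0 < m" by (simp add: m_def)
  have "real (length ?s) powr (1 / 3) \<le> ((6 * real m) ^ 3) powr (1 / 3)"
  proof (rule powr_mono2)
    have "real (length ?s) \<le> real (216 * m ^ 3)"
      using length_lz_text(2)[OF m] by (simp only: of_nat_le_iff)
    then show "real (length ?s) \<le> (6 * real m) ^ 3" by (simp add: power_mult_distrib)
  qed auto
  also have "\<dots> = 6 * real m"
    by (rule cube_powr_third) (simp add: m)
  finally have n: "real (length ?s) powr (1 / 3) \<le> 6 * real m" .
  have "real (length ?s) powr (1 / 3) * real (smallest_grammar_size ?s) \<le> (6 * real m) * (110 * real m)"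
    using n smallest_grammar_size_lz_text[OF m] by (intro mult_mono) auto
  then have bound: "1 / 660 * real (length ?s) powr (1 / 3) * real (smallest_grammar_size ?s) \<le> real (m * m)"
    by simp
  note parsings = parses_imp_parsings[OF lz_pairs_parses[OF m], folded lz_text_def]
  have "m * m \<le> grammar_size (lzd_grammar {..6} ?s)"
    using lzd_grammar_size_ge[OF parsings(1) set_lz_text] length_lz_pairs[of m] by simp
  then have lzd: "1 / 660 * real (length ?s) powr (1 / 3) * real (smallest_grammar_size ?s)
      \<le> real (grammar_size (lzd_grammar {..6} ?s))"
    by (intro order_trans[OF bound]) (simp only: of_nat_le_iff)
  have "m * m \<le> grammar_size (lzmw_grammar {..6} ?s)"
    using lzmw_grammar_size_ge[OF parsings(2) set_lz_text] length_lz_pairs[of m] by (simp add: length_flat)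
  then have lzmw: "1 / 660 * real (length ?s) powr (1 / 3) * real (smallest_grammar_size ?s)
      \<le> real (grammar_size (lzmw_grammar {..6} ?s))"
    by (intro order_trans[OF bound]) (simp only: of_nat_le_iff)
  have "N \<le> length ?s" using length_lz_text(1)[OF m] by (simp add: m_def)
  then show "\<exists>n \<ge> N.
        (\<exists>s :: nat list. length s = n \<and> set s \<subseteq> {..6} \<and> dollar_terminated 6 s \<and>
           real (grammar_size (lzd_grammar {..6} s))
             \<ge> 1 / 660 * real n powr (1/3) * real (smallest_grammar_size s)) \<and>
        (\<exists>s :: nat list. length s = n \<and> set s \<subseteq> {..6} \<and> dollar_terminated 6 s \<and>
           real (grammar_size (lzmw_grammar {..6} s))
             \<ge> 1 / 660 * real n powr (1/3) * real (smallest_grammar_size s))"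
    using lzd lzmw lz_text_dollar set_lz_text by blast
qed auto

end
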